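(* Let $k>0$ and let $\phi$ be a bounded (measurable) function such that the map $\tilde\phi:\theta\mapsto E_{Q^\theta}[\phi(X)]$ is twice differentiable on $\Theta$. Then for all $P\in\mathcal{Q}$, $$\mathcal{E}^{k,\infty}_{\mathcal{Q}|\mathbf{x}_N}(\phi(X))=E_{\hat\theta_N}[\phi(X)]+\sqrt{\frac{2k}{N}V(\phi,\hat\theta_N)}+O_P(N^{-3/4}).$$
   Context: Setting. $\Theta\subseteq\mathbb{R}^d$ is open and $\mathcal{Q}=\{Q^\theta:\theta\in\Theta\}$ is an exponential family in natural parameters: under $Q^\theta$ the random variables $X,X_1,X_2,\dots$ are iid with density $$f(x;Q^\theta)=h(x)\exp\{\langle\theta,T(x)\rangle-A(\theta)\},$$ where $T$ is an $\mathbb{R}^d$-valued sufficient statistic, $h$ a normalization function and $A$ the log-partition function (convex and smooth). $\mathcal{Q}$ consists of all such measures with $\theta\in\Theta$; $\theta_Q$ denotes the parameter of $Q$, and $E_\theta=E_{Q^\theta}$. Write $\mathbf{x}_N=(X_1,\dots,X_N)$, $L(Q|\mathbf{x}_N)=\prod_{n=1}^N f(X_n;Q)$. Standing assumptions: (a) the Hessian $\mathfrak{I}_\theta=\partial^2A(\theta)$ is strictly positive definite at every $\theta\in\Theta$; (b) for every $Q\in\mathcal{Q}$, with $Q$-probability tending to $1$ as $N\to\infty$ a maximizer $\hat Q_N\in\mathcal{Q}$ of the likelihood $L(\cdot|\mathbf{x}_N)$ exists, and $\hat\theta_N=\theta_{\hat Q_N}\to\theta_Q$ in $Q$-probability. Divergence: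 $\alpha_{\mathcal{Q}|\mathbf{x}_N}(Q)=-\log L(Q|\mathbf{x}_N)+\sup_{\tilde Q\in\mathcal{Q}}\log L(\tilde Q|\mathbf{x}_N)$. DR-expectation with $\gamma=\infty$: $\mathcal{E}^{k,\infty}_{\mathcal{Q}|\mathbf{x}_N}(\xi)=\sup_{Q\in\mathcal{Q}}\{E_Q[\xi|\mathbf{x}_N]-(\frac1k\alpha_{\mathcal{Q}|\mathbf{x}_N}(Q))^\infty\}$ with the convention $x^\infty=0$ for $x\in[0,1]$ and $x^\infty=+\infty$ for $x>1$; that is, the supremum of $E_Q[\xi|\mathbf{x}_N]$ over $Q\in\mathcal{Q}$ with $\alpha_{\mathcal{Q}|\mathbf{x}_N}(Q)\le k$. For $\xi=\phi(X)$, $E_Q[\xi|\mathbf{x}_N]=E_Q[\phi(X)]$ by independence. $V(\phi,\hat\theta)=(\partial\tilde\phi|_{\hat\theta})^\top\,\mathfrak{I}_{\hat\theta}^{-1}\,(\partial\tilde\phi|_{\hat\theta})$, where $\partial\tilde\phi$ is the gradient of $\tilde\phi$. $Y_N=O_P(g(N))$ means $\lim_{M\to\infty}\limsup_{N\to\infty}P(|Y_N/g(N)|>M)=0$ (events on which the MLE fails to exist have $P$-probability tending to $0$ and are disregarded). *)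

theory Defs
  imports "HOL-Probability.Probability"
begin

subsection \<open>Calculus\<close>

definition gradient :: "(real ^ 'n \<Rightarrow> real) \<Rightarrow> real ^ 'n \<Rightarrow> real ^ 'n" where
  "gradient f x = (\<chi> i. frechet_derivative f (at x) (axis i 1))"

definition hessian :: "(real ^ 'n \<Rightarrow> real) \<Rightarrow> real ^ 'n \<Rightarrow> real ^ 'n ^ 'n" where
  "hessian f x = jacobian (gradient f) (at x)"

definition pos_definite :: "real ^ 'n ^ 'n \<Rightarrow> bool" where
  "pos_definite H \<longleftrightarrow> transpose H = H \<and> (\<forall>v. v \<noteq> 0 \<longrightarrow> v \<bullet> (H *v v) > 0)"

text \<open>Frechet differentiability of the map and of its gradient at every point of an open set;
  the second derivative need not be continuous.\<close>

definition twice_differentiable_on :: "(real ^ 'n) set \<Rightarrow> (real ^ 'n \<Rightarrow> real) \<Rightarrow> bool" where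
  "twice_differentiable_on S f \<longleftrightarrow>
     (\<forall>x\<in>S. f differentiable (at x)) \<and> (\<forall>x\<in>S. gradient f differentiable (at x))"

text \<open>For open \<open>S\<close>: \<open>f\<close> is of class \<open>C^m\<close> on \<open>S\<close>.\<close>

primrec C_class_on :: "nat \<Rightarrow> (real ^ 'n) set \<Rightarrow> (real ^ 'n \<Rightarrow> real) \<Rightarrow> bool" where
  "C_class_on 0 S f \<longleftrightarrow> continuous_on S f"
| "C_class_on (Suc m) S f \<longleftrightarrow>
     (\<forall>x\<in>S. f differentiable (at x)) \<and> (\<forall>v. C_class_on m S (\<lambda>x. frechet_derivative f (at x) v))"

definition smooth_on :: "(real ^ 'n) set \<Rightarrow> (real ^ 'n \<Rightarrow> real) \<Rightarrow> bool" where
  "smooth_on S f \<longleftrightarrow> (\<forall>m. C_class_on m S f)"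

subsection \<open>Exponential families in natural parameters\<close>

definition exp_density ::
  "('x \<Rightarrow> real) \<Rightarrow> ('x \<Rightarrow> real ^ 'n) \<Rightarrow> (real ^ 'n \<Rightarrow> real) \<Rightarrow> real ^ 'n \<Rightarrow> 'x \<Rightarrow> real" where
  "exp_density h T A \<theta> x = h x * exp (\<theta> \<bullet> T x - A \<theta>)"

text \<open>
  The measures \<open>Q \<theta>\<close> live on one common measurable space and are indexed by their parameter, so
  the family is \<open>Q ` \<Theta>\<close>. \<open>X 0\<close> is the generic copy \<open>X\<close>; the observations are \<open>X 1, X 2, \<dots>\<close>.
  All of them have the stated density with respect to the reference measure \<open>\<mu>\<close>. Since densities
  integrate to 1, \<open>A\<close> is on \<open>\<Theta>\<close> the log-partition function \<open>\<lambda>\<theta>. ln (\<integral>x. h x * exp (\<theta> \<bullet> T x) \<partial>\<mu>)\<close>,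
  whose convexity along segments is a consequence (and \<open>\<Theta>\<close> itself is not required to be convex).
\<close>

locale exponential_family =
  fixes \<Theta> :: "(real ^ 'n) set"
    and \<mu> :: "'x measure"
    and h :: "'x \<Rightarrow> real"
    and T :: "'x \<Rightarrow> real ^ 'n"
    and A :: "real ^ 'n \<Rightarrow> real"
    and Q :: "real ^ 'n \<Rightarrow> 'w measure"
    and X :: "nat \<Rightarrow> 'w \<Rightarrow> 'x"
  assumes open_params: "open \<Theta>"
    and h_measurable: "h \<in> borel_measurable \<mu>"
    and h_nonneg: "\<And>x. x \<in> space \<mu> \<Longrightarrow> h x \<ge> 0"
    and T_measurable: "T \<in> borel_measurable \<mu>"
    and A_smooth: "smooth_on \<Theta> A"
    and prob: "\<And>\<theta>. \<theta> \<in> \<Theta> \<Longrightarrow> prob_space (Q \<theta>)"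
    and sets_eq: "\<And>\<theta> \<theta>'. \<theta> \<in> \<Theta> \<Longrightarrow> \<theta>' \<in> \<Theta> \<Longrightarrow> sets (Q \<theta>) = sets (Q \<theta>')"
    and indep: "\<And>\<theta>. \<theta> \<in> \<Theta> \<Longrightarrow> prob_space.indep_vars (Q \<theta>) (\<lambda>_. \<mu>) X UNIV"
    and has_density: "\<And>\<theta> n. \<theta> \<in> \<Theta> \<Longrightarrow>
           distributed (Q \<theta>) \<mu> (X n) (\<lambda>x. ennreal (exp_density h T A \<theta> x))"

subsection \<open>Likelihood, maximum likelihood, divergence\<close>

text \<open>A data set of size \<open>N\<close> is the segment \<open>x 1, \<dots>, x N\<close> of a sequence \<open>x\<close>.\<close>

definition likelihood ::
  "('x \<Rightarrow> real) \<Rightarrow> ('x \<Rightarrow> real ^ 'n) \<Rightarrow> (real ^ 'n \<Rightarrow> real) \<Rightarrow> nat \<Rightarrow> (nat \<Rightarrow> 'x) \<Rightarrow> real ^ 'n \<Rightarrow> real" where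
  "likelihood h T A N x \<theta> = (\<Prod>n=1..N. exp_density h T A \<theta> (x n))"

text \<open>Logarithm of a nonnegative real with \<open>log 0 = -\<infinity>\<close> (whereas \<open>ln 0 = 0\<close> on type \<open>real\<close>).\<close>

definition ext_ln :: "real \<Rightarrow> ereal" where
  "ext_ln y = (if y > 0 then ereal (ln y) else -\<infinity>)"

definition divergence ::
  "(real ^ 'n) set \<Rightarrow> (real ^ 'n \<Rightarrow> real) \<Rightarrow> real ^ 'n \<Rightarrow> ereal" where
  "divergence \<Theta> L \<theta> = - ext_ln (L \<theta>) + (SUP \<theta>'\<in>\<Theta>. ext_ln (L \<theta>'))"

definition is_mle :: "(real ^ 'n) set \<Rightarrow> (real ^ 'n \<Rightarrow> real) \<Rightarrow> real ^ 'n \<Rightarrow> bool" where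
  "is_mle \<Theta> L \<theta> \<longleftrightarrow> is_arg_max L (\<lambda>\<theta>. \<theta> \<in> \<Theta>) \<theta>"

text \<open>
  \<open>\<theta>hat N \<omega>\<close> is a maximizer of the likelihood in \<open>\<Theta>\<close> whenever there is one (its value is
  unconstrained otherwise); under every member of the family, a maximizer exists with probability
  tending to 1 and \<open>\<theta>hat\<close> is consistent. The outer measure is the probability on measurable events;
  it spares a choice of measurable versions.
\<close>

definition consistent_mle ::
  "(real ^ 'n) set \<Rightarrow> ('x \<Rightarrow> real) \<Rightarrow> ('x \<Rightarrow> real ^ 'n) \<Rightarrow> (real ^ 'n \<Rightarrow> real) \<Rightarrow>
   (real ^ 'n \<Rightarrow> 'w measure) \<Rightarrow> (nat \<Rightarrow> 'w \<Rightarrow> 'x) \<Rightarrow> (nat \<Rightarrow> 'w \<Rightarrow> real ^ 'n) \<Rightarrow> bool" where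
  "consistent_mle \<Theta> h T A Q X \<theta>hat \<longleftrightarrow>
     (let L = (\<lambda>N \<omega>. likelihood h T A N (\<lambda>n. X n \<omega>)) in
      (\<forall>\<theta>\<in>\<Theta>. \<forall>N. \<forall>\<omega>\<in>space (Q \<theta>).
         (\<exists>\<theta>'. is_mle \<Theta> (L N \<omega>) \<theta>') \<longrightarrow> is_mle \<Theta> (L N \<omega>) (\<theta>hat N \<omega>)) \<and>
      (\<forall>\<theta>\<in>\<Theta>. (\<lambda>N. outer_measure_of (Q \<theta>)
         {\<omega> \<in> space (Q \<theta>). \<not> (\<exists>\<theta>'. is_mle \<Theta> (L N \<omega>) \<theta>')}) \<longlonglongrightarrow> 0) \<and>
      (\<forall>\<theta>\<in>\<Theta>. \<forall>\<epsilon>>0. (\<lambda>N. outer_measure_of (Q \<theta>)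
         {\<omega> \<in> space (Q \<theta>). dist (\<theta>hat N \<omega>) \<theta> > \<epsilon>}) \<longlonglongrightarrow> 0))"

subsection \<open>DR-expectation with \<open>\<gamma> = \<infinity>\<close>\<close>

text \<open>The convention for \<open>x^\<infinity>\<close>, used for \<open>x \<ge> 0\<close>.\<close>

definition pow_infinity :: "ereal \<Rightarrow> ereal" where
  "pow_infinity x = (if x \<le> 1 then 0 else \<infinity>)"

text \<open>\<open>e \<theta>\<close> is the conditional expectation of \<open>\<xi>\<close> given the data under the parameter \<open>\<theta>\<close>, \<open>L\<close> the
  likelihood of the data. For \<open>\<xi> = \<phi> (X 0)\<close>, which is independent of the data,
  \<open>e \<theta>\<close> is \<open>mean_of Q X \<phi> \<theta>\<close>.\<close>

definition dr_expectation ::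
  "real \<Rightarrow> (real ^ 'n) set \<Rightarrow> (real ^ 'n \<Rightarrow> real) \<Rightarrow> (real ^ 'n \<Rightarrow> real) \<Rightarrow> ereal" where
  "dr_expectation k \<Theta> L e =
     (SUP \<theta>\<in>\<Theta>. ereal (e \<theta>) - pow_infinity (ereal (1 / k) * divergence \<Theta> L \<theta>))"

definition mean_of ::
  "(real ^ 'n \<Rightarrow> 'w measure) \<Rightarrow> (nat \<Rightarrow> 'w \<Rightarrow> 'x) \<Rightarrow> ('x \<Rightarrow> real) \<Rightarrow> real ^ 'n \<Rightarrow> real" where
  "mean_of Q X \<phi> \<theta> = (\<integral>\<omega>. \<phi> (X 0 \<omega>) \<partial>Q \<theta>)"

definition asym_variance ::
  "(real ^ 'n \<Rightarrow> real) \<Rightarrow> (real ^ 'n \<Rightarrow> real) \<Rightarrow> real ^ 'n \<Rightarrow> real" where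
  "asym_variance A m \<theta> = gradient m \<theta> \<bullet> (matrix_inv (hessian A \<theta>) *v gradient m \<theta>)"

subsection \<open>Boundedness in probability\<close>

text \<open>\<open>Y N = O_P (g N)\<close> under \<open>P\<close>, for extended-real-valued \<open>Y\<close>. Arbitrary values of \<open>Y N\<close> on events of
  probability tending to 0 do not affect it.\<close>

definition bigO_prob :: "'w measure \<Rightarrow> (nat \<Rightarrow> 'w \<Rightarrow> ereal) \<Rightarrow> (nat \<Rightarrow> real) \<Rightarrow> bool" where
  "bigO_prob P Y g \<longleftrightarrow>
     ((\<lambda>M. limsup (\<lambda>N. outer_measure_of P {\<omega> \<in> space P. \<bar>Y N \<omega> / ereal (g N)\<bar> > ereal M}))
        \<longlongrightarrow> 0) at_top"

end

theory Submission
  imports Defs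
begin

text \<open>
  Stationarity of the log-likelihood at the maximizer \<open>p\<close> turns the divergence at \<open>y\<close> into
  \<open>N * D y\<close> with the Bregman divergence \<open>D y = A y - A p - \<langle>gradient A p, y - p\<rangle>\<close>, so the
  DR-expectation is the supremum of the mean \<open>m\<close> over \<open>{D \<le> k/N}\<close>. A third-order Taylor
  expansion of \<open>A\<close> shows that this set is an ellipsoid up to a perturbation of order \<open>N\<^sup>-\<^sup>3\<^sup>/\<^sup>2\<close> in the
  level; the linear part of \<open>m\<close> has maximum \<open>sqrt (2 * k / N * V)\<close> on the ellipsoid, and by
  \<open>sqrt (a + b) \<le> sqrt a + sqrt b\<close> the perturbation costs order \<open>N\<^sup>-\<^sup>3\<^sup>/\<^sup>4\<close>.

  The second derivative of \<open>m\<close> is not assumed to be locally bounded. Instead, for a bounded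
  statistic \<open>\<psi> \<ge> 0\<close> the function \<open>\<theta> \<mapsto> exp (A \<theta> - \<langle>\<theta>, v\<rangle>) * E\<^sub>\<theta> \<psi>\<close> is an integral of exponentials
  and hence convex, for every \<open>v\<close>. Its tangent inequality at \<open>p\<close> with \<open>v = gradient A p\<close>, applied
  to \<open>\<psi> = B + \<phi>\<close> and \<open>\<psi> = B - \<phi>\<close> where \<open>\<bar>\<phi>\<bar> \<le> B\<close>, bounds the first-order Taylor remainder of \<open>m\<close> by
  \<open>2 * B * (exp (D y) - 1)\<close>, which is \<open>O(1/N)\<close> on \<open>{D \<le> k/N}\<close>. The case \<open>\<psi> = 1\<close> gives \<open>D \<ge> 0\<close> and
  the monotonicity of \<open>D\<close> along segments from \<open>p\<close>, which confines \<open>{D \<le> k/N}\<close> to a small ball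
  although \<open>\<Theta>\<close> need not be convex.
\<close>

subsection \<open>Gradient, Hessian and Taylor expansion\<close>

lemma has_derivative_gradient:
  fixes f :: "real ^ 'n \<Rightarrow> real"
  assumes "f differentiable (at x)"
  shows "(f has_derivative (\<lambda>h. gradient f x \<bullet> h)) (at x)"
proof -
  have d: "(f has_derivative frechet_derivative f (at x)) (at x)"
    using assms frechet_derivative_works by blast
  then have l: "linear (frechet_derivative f (at x))"
    using has_derivative_linear by blast
  have "frechet_derivative f (at x) h = gradient f x \<bullet> h" for h
  proof -
    have "frechet_derivative f (at x) h = frechet_derivative f (at x) (\<Sum>i\<in>UNIV. h $ i *\<^sub>R axis i 1)"
      using basis_expansion[of h] by (simp add: scalar_mult_eq_scaleR)
    also have "\<dots> = (\<Sum>i\<in>UNIV. h $ i * frechet_derivative f (at x) (axis i 1))"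
      using l by (simp add: linear_sum linear_cmul)
    also have "\<dots> = gradient f x \<bullet> h"
      by (simp add: inner_vec_def gradient_def mult.commute)
    finally show ?thesis .
  qed
  then show ?thesis using d by (metis (no_types, lifting) ext)
qed

lemma C_class_on_SucD: "C_class_on (Suc m) S f \<Longrightarrow> C_class_on m S f"
proof (induction m arbitrary: f)
  case 0
  then show ?case
    by (auto intro!: continuous_at_imp_continuous_on differentiable_imp_continuous_within)
next
  case (Suc m)
  then show ?case by simp
qed

text \<open>Compactness of the ball bounds the continuous partial derivatives, and its convexity
  lets the mean value inequality turn that bound into a Lipschitz constant.\<close>

lemma C_class_on_1_lipschitz:
  fixes f :: "real ^ 'n \<Rightarrow> real"
  assumes f: "C_class_on 1 S f" and sub: "cball z r \<subseteq> S"
  shows "\<exists>K. \<forall>x\<in>cball z r. \<forall>y\<in>cball z r. \<bar>f x - f y\<bar> \<le> K * norm (x - y)"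
proof -
  have df: "f differentiable (at x)" if "x \<in> cball z r" for x
    using f sub that by auto
  have "\<exists>B. \<forall>x\<in>cball z r. \<bar>gradient f x $ i\<bar> \<le> B" for i
  proof -
    have "continuous_on S (\<lambda>x. frechet_derivative f (at x) (axis i 1))"
      using f by simp
    then have "continuous_on (cball z r) (\<lambda>x. gradient f x $ i)"
      using sub continuous_on_subset by (fastforce simp: gradient_def)
    then have "bounded ((\<lambda>x. gradient f x $ i) ` cball z r)"
      by (intro compact_imp_bounded compact_continuous_image) auto
    then show ?thesis unfolding bounded_iff by auto
  qed
  then obtain B where B: "\<And>i x. x \<in> cball z r \<Longrightarrow> \<bar>gradient f x $ i\<bar> \<le> B i" by metis
  have "\<bar>f x - f y\<bar> \<le> (\<Sum>i\<in>UNIV. B i) * norm (x - y)"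
    if xy: "x \<in> cball z r" "y \<in> cball z r" for x y
  proof -
    have "norm (f x - f y) \<le> (\<Sum>i\<in>UNIV. B i) * norm (x - y)"
    proof (rule differentiable_bound[OF convex_cball _ _ xy])
      fix u assume u: "u \<in> cball z r"
      show "(f has_derivative (\<lambda>h. gradient f u \<bullet> h)) (at u within cball z r)"
        using has_derivative_gradient[OF df[OF u]] has_derivative_at_withinI by blast
      have "norm (gradient f u) \<le> (\<Sum>i\<in>UNIV. B i)"
        by (rule order_trans[OF norm_le_l1_cart sum_mono]) (rule B[OF u])
      then show "onorm (\<lambda>h. gradient f u \<bullet> h) \<le> (\<Sum>i\<in>UNIV. B i)"
        by (intro onorm_le) (metis Cauchy_Schwarz_ineq2 mult_right_mono norm_ge_zero order_trans real_norm_def)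
    qed
    then show ?thesis by simp
  qed
  then show ?thesis by blast
qed

text \<open>Links \<open>C_class_on\<close>, phrased by iterated directional derivatives, to
  \<open>hessian\<close>, phrased by the Jacobian of the gradient; the entry formula lets the
  Hessian entries inherit further regularity.\<close>

lemma C_class_on_2_gradient:
  fixes f :: "real ^ 'n \<Rightarrow> real"
  assumes f: "C_class_on 2 S f" and x: "x \<in> S"
  shows "(gradient f has_derivative (\<lambda>h. hessian f x *v h)) (at x)"
    and "hessian f x $ i $ j = frechet_derivative (\<lambda>y. frechet_derivative f (at y) (axis i 1)) (at x) (axis j 1)"
proof -
  have d: "(\<lambda>y. frechet_derivative f (at y) (axis i 1)) differentiable (at x)" for i
    using f x by (simp add: eval_nat_numeral)
  then have "((\<lambda>y. \<chi> i. frechet_derivative f (at y) (axis i 1)) has_derivative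
      (\<lambda>h. \<chi> i. frechet_derivative (\<lambda>y. frechet_derivative f (at y) (axis i 1)) (at x) h)) (at x)"
    by (subst has_derivative_componentwise_within)
      (auto simp: Basis_vec_def inner_axis frechet_derivative_works)
  then have *: "(gradient f has_derivative
      (\<lambda>h. \<chi> i. frechet_derivative (\<lambda>y. frechet_derivative f (at y) (axis i 1)) (at x) h)) (at x)"
    by (simp add: gradient_def[abs_def])
  then have "gradient f differentiable (at x)" unfolding differentiable_def by blast
  then show "(gradient f has_derivative (\<lambda>h. hessian f x *v h)) (at x)"
    by (simp add: hessian_def jacobian_works)
  show "hessian f x $ i $ j = frechet_derivative (\<lambda>y. frechet_derivative f (at y) (axis i 1)) (at x) (axis j 1)"
    by (simp add: hessian_def jacobian_def matrix_def frechet_derivative_at[OF *, symmetric])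
qed

lemma C_class_on_2_continuous_hessian:
  fixes f :: "real ^ 'n \<Rightarrow> real"
  assumes "C_class_on 2 S f" "U \<subseteq> S"
  shows "continuous_on U (\<lambda>x. hessian f x $ i $ j)"
proof -
  have "continuous_on S (\<lambda>x. frechet_derivative (\<lambda>y. frechet_derivative f (at y) (axis i 1)) (at x) (axis j 1))"
    using assms(1) by (simp add: eval_nat_numeral)
  then have "continuous_on S (\<lambda>x. hessian f x $ i $ j)"
    by (rule continuous_on_eq) (simp add: C_class_on_2_gradient(2)[OF assms(1)])
  then show ?thesis using assms(2) continuous_on_subset by blast
qed

lemma C_class_on_3_hessian_lipschitz:
  fixes f :: "real ^ 'n \<Rightarrow> real"
  assumes f: "C_class_on 3 S f" and sub: "cball z r \<subseteq> S"
  shows "\<exists>K\<ge>0. \<forall>x\<in>cball z r. \<forall>y\<in>cball z r. \<forall>i j. \<bar>hessian f x $ i $ j - hessian f y $ i $ j\<bar> \<le> K * norm (x - y)"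
proof -
  define F where "F i j x = frechet_derivative (\<lambda>y. frechet_derivative f (at y) (axis i 1)) (at x) (axis j 1)" for i j x
  have "C_class_on 2 S f" by (rule C_class_on_SucD) (use f in \<open>simp only: numeral_3_eq_3 numeral_2_eq_2\<close>)
  then have F: "hessian f x $ i $ j = F i j x" if "x \<in> cball z r" for i j x
    using C_class_on_2_gradient(2) sub that unfolding F_def by blast
  have "C_class_on 1 S (F i j)" for i j
    using f by (simp add: eval_nat_numeral F_def[abs_def])
  then have "\<exists>K. \<forall>x\<in>cball z r. \<forall>y\<in>cball z r. \<bar>F i j x - F i j y\<bar> \<le> K * norm (x - y)" for i j
    using C_class_on_1_lipschitz sub by blast
  then obtain K where K: "\<And>i j x y. x \<in> cball z r \<Longrightarrow> y \<in> cball z r \<Longrightarrow> \<bar>F i j x - F i j y\<bar> \<le> K i j * norm (x - y)"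
    by metis
  \<comment> \<open>A single constant for all entries: the sum dominates each \<open>K i j\<close>,
    whatever its sign.\<close>
  define K' where "K' = (\<Sum>i\<in>UNIV. \<Sum>j\<in>UNIV. \<bar>K i j\<bar>)"
  have KK: "K i j \<le> K'" for i j
  proof -
    have "\<bar>K i j\<bar> \<le> (\<Sum>j\<in>UNIV. \<bar>K i j\<bar>)" by (rule member_le_sum) auto
    also have "\<dots> \<le> K'" unfolding K'_def
      by (rule member_le_sum[where f="\<lambda>i. \<Sum>j\<in>UNIV. \<bar>K i j\<bar>"]) (auto intro: sum_nonneg)
    finally show ?thesis by simp
  qed
  have "K' \<ge> 0" unfolding K'_def by (intro sum_nonneg) auto
  moreover have "\<bar>F i j x - F i j y\<bar> \<le> K' * norm (x - y)" if "x \<in> cball z r" "y \<in> cball z r" for i j x y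
    using K[OF that, of i j] KK[of i j] by (meson mult_right_mono norm_ge_zero order_trans)
  ultimately show ?thesis using F by (metis)
qed

text \<open>The mean value inequality is applied twice, first to the gradient and then along the
  segment from \<open>x\<close> to \<open>y\<close>. The constant is uniform in the base point
  \<open>x\<close>, since the expansion will be made at a data-dependent maximizer.\<close>

lemma C_class_on_3_taylor:
  fixes f :: "real ^ 'n \<Rightarrow> real"
  assumes f: "C_class_on 3 S f" and sub: "cball z r \<subseteq> S"
  shows "\<exists>K\<ge>0. \<forall>x\<in>cball z r. \<forall>y\<in>cball z r.
    \<bar>f y - f x - gradient f x \<bullet> (y - x) - (y - x) \<bullet> (hessian f x *v (y - x)) / 2\<bar> \<le> K * norm (y - x) ^ 3"
proof -
  obtain K where K0: "K \<ge> 0" and K: "\<And>x y i j. x\<in>cball z r \<Longrightarrow> y\<in>cball z r \<Longrightarrow>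
      \<bar>hessian f x $ i $ j - hessian f y $ i $ j\<bar> \<le> K * norm (x - y)"
    using C_class_on_3_hessian_lipschitz[OF assms] by blast
  have f2: "C_class_on 2 S f" by (rule C_class_on_SucD) (use f in \<open>simp only: numeral_3_eq_3 numeral_2_eq_2\<close>)
  \<comment> \<open>The number of matrix entries: the operator norm is at most \<open>c\<close>
    times a bound on the entries.\<close>
  define c where "c = real CARD('n) * real CARD('n)"
  have g1: "norm (gradient f y - gradient f x - hessian f x *v (y - x)) \<le> c * K * norm (y - x) ^ 2"
    if x: "x \<in> cball z r" and y: "y \<in> cball z r" for x y
  proof -
    \<comment> \<open>Intersecting with the ball around \<open>x\<close> through \<open>y\<close>
      keeps the domain convex and limits the variation of the Hessian to
      \<open>K * norm (y - x)\<close>.\<close>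
    let ?U = "cball z r \<inter> cball x (norm (y - x))"
    have "norm ((gradient f y - hessian f x *v y) - (gradient f x - hessian f x *v x))
        \<le> (c * (K * norm (y - x))) * norm (y - x)"
    proof (rule differentiable_bound[where S = ?U])
      show "convex ?U" by (intro convex_Int convex_cball)
      show "y \<in> ?U" "x \<in> ?U" using x y by (auto simp: dist_norm norm_minus_commute)
      fix u assume u: "u \<in> ?U"
      then have "(gradient f has_derivative (\<lambda>h. hessian f u *v h)) (at u)"
        using C_class_on_2_gradient[OF f2] sub by blast
      then have "((\<lambda>v. gradient f v - hessian f x *v v) has_derivative (\<lambda>h. hessian f u *v h - hessian f x *v h)) (at u)"
        by (intro has_derivative_diff bounded_linear.has_derivative[OF matrix_vector_mul_bounded_linear has_derivative_ident])
      then show "((\<lambda>v. gradient f v - hessian f x *v v) has_derivative (\<lambda>h. (hessian f u - hessian f x) *v h)) (at u within ?U)"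
        by (simp add: matrix_vector_mult_diff_rdistrib has_derivative_at_withinI)
      have "\<bar>(hessian f u - hessian f x) $ i $ j\<bar> \<le> K * norm (y - x)" for i j
      proof -
        have "\<bar>(hessian f u - hessian f x) $ i $ j\<bar> \<le> K * norm (u - x)"
          using K[of u x i j] u x by simp
        also have "\<dots> \<le> K * norm (y - x)"
          using u K0 by (intro mult_left_mono) (auto simp: dist_norm norm_minus_commute)
        finally show ?thesis .
      qed
      then show "onorm (\<lambda>h. (hessian f u - hessian f x) *v h) \<le> c * (K * norm (y - x))"
        unfolding c_def by (rule onorm_le_matrix_component)
    qed
    then show ?thesis
      by (simp add: matrix_vector_mult_diff_distrib power2_eq_square algebra_simps)
  qed
  have "\<bar>f y - f x - gradient f x \<bullet> (y - x) - (y - x) \<bullet> (hessian f x *v (y - x)) / 2\<bar> \<le> c * K * norm (y - x) ^ 3"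
    if x: "x \<in> cball z r" and y: "y \<in> cball z r" for x y
  proof -
    define d where "d = y - x"
    \<comment> \<open>The increment of \<open>q\<close> over \<open>[0, 1]\<close> is the Taylor
      remainder; its derivative is the remainder of the gradient paired with \<open>d\<close>, which
      \<open>g1\<close> controls.\<close>
    define q where "q t = f (x + t *\<^sub>R d) - t * (gradient f x \<bullet> d) - t\<^sup>2 / 2 * (d \<bullet> (hessian f x *v d))" for t :: real
    have seg: "x + t *\<^sub>R d \<in> cball z r" if "t \<in> {0..1}" for t
    proof -
      have "(1 - t) *\<^sub>R x + t *\<^sub>R y \<in> cball z r"
        using that x y by (intro convexD[OF convex_cball]) auto
      then show ?thesis by (simp add: d_def algebra_simps)
    qed
    have "norm (q 1 - q 0) \<le> c * K * norm d ^ 3 * norm (1 - 0 :: real)"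
    proof (rule field_differentiable_bound[where S = "{0..1}"])
      fix t :: real assume t: "t \<in> {0..1}"
      let ?w = "x + t *\<^sub>R d"
      let ?q' = "gradient f ?w \<bullet> d - gradient f x \<bullet> d - t * (d \<bullet> (hessian f x *v d))"
      have "f differentiable (at ?w)" using f2 sub seg[OF t] by (auto simp: eval_nat_numeral)
      note has_derivative_gradient[OF this]
      then have "((\<lambda>t. f (x + t *\<^sub>R d)) has_derivative (\<lambda>s. gradient f ?w \<bullet> (s *\<^sub>R d))) (at t)"
        by (rule has_derivative_compose[rotated]) (auto intro!: derivative_eq_intros)
      then have "((\<lambda>t. f (x + t *\<^sub>R d)) has_field_derivative gradient f ?w \<bullet> d) (at t)"
        by (simp add: has_field_derivative_def mult.commute[of _ "gradient f ?w \<bullet> d"])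
      then have "(q has_field_derivative ?q') (at t)"
        unfolding q_def by (auto intro!: derivative_eq_intros)
      then show "(q has_field_derivative ?q') (at t within {0..1})"
        by (rule has_field_derivative_at_within)
      have "?q' = (gradient f ?w - gradient f x - hessian f x *v (?w - x)) \<bullet> d"
        by (simp add: inner_diff_left matrix_vector_mult_scaleR inner_commute[of d])
      also have "\<bar>\<dots>\<bar> \<le> (c * K * norm (?w - x) ^ 2) * norm d"
        using g1[OF x seg[OF t]]
        by (meson Cauchy_Schwarz_ineq2 mult_right_mono norm_ge_zero order_trans)
      also have "\<dots> \<le> (c * K * norm d ^ 2) * norm d"
        using t K0 by (intro mult_right_mono mult_left_mono power_mono) (auto simp: c_def mult_left_le_one_le)
      finally show "norm ?q' \<le> c * K * norm d ^ 3"
        by (simp add: power2_eq_square power3_eq_cube mult.assoc)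
    qed auto
    moreover have "q 1 - q 0 = f y - f x - gradient f x \<bullet> d - d \<bullet> (hessian f x *v d) / 2"
      by (simp add: q_def d_def)
    ultimately show ?thesis by (simp add: d_def)
  qed
  moreover have "c * K \<ge> 0" using K0 by (simp add: c_def)
  ultimately show ?thesis by blast
qed


subsection \<open>Convexity in exponential families\<close>

text \<open>Only difference quotients at \<open>p\<close> for small \<open>t > 0\<close> enter the
  limit, and those points lie in the open set \<open>S\<close>. The chord inequality is therefore
  asked for only at points of the segment in \<open>S\<close>, which suits a parameter set that is
  not convex.\<close>

lemma tangent_le_of_convex_at:
  fixes f :: "'a::real_normed_vector \<Rightarrow> real"
  assumes S: "open S" "p \<in> S" and f: "(f has_derivative f') (at p)"
    and conv: "\<And>t. 0 \<le> t \<Longrightarrow> t \<le> 1 \<Longrightarrow> (1 - t) *\<^sub>R p + t *\<^sub>R y \<in> S \<Longrightarrow>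
      f ((1 - t) *\<^sub>R p + t *\<^sub>R y) \<le> (1 - t) * f p + t * f y"
  shows "f' (y - p) \<le> f y - f p"
proof -
  let ?l = "\<lambda>t. p + t *\<^sub>R (y - p)"
  have l: "?l t = (1 - t) *\<^sub>R p + t *\<^sub>R y" for t by (simp add: algebra_simps)
  have f': "(f has_derivative f') (at (?l 0))" using f by simp
  have "((\<lambda>t. f (?l t)) has_derivative (\<lambda>s. f' (s *\<^sub>R (y - p)))) (at 0)"
    using f' by (rule has_derivative_compose[rotated]) (auto intro!: derivative_eq_intros)
  then have "((\<lambda>t. f (?l t)) has_field_derivative f' (y - p)) (at 0)"
    using has_derivative_linear[OF f]
    by (simp add: has_field_derivative_def linear_cmul mult.commute[of _ "f' (y - p)"])
  then have "((\<lambda>t. (f (?l t) - f p) / t) \<longlongrightarrow> f' (y - p)) (at_right 0)"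
    by (auto simp: has_field_derivative_iff intro: tendsto_within_subset)
  moreover have "\<forall>\<^sub>F t in at_right 0. (f (?l t) - f p) / t \<le> f y - f p"
  proof -
    have "(?l \<longlongrightarrow> ?l 0) (at_right 0)" by (intro tendsto_intros)
    then have "\<forall>\<^sub>F t in at_right 0. ?l t \<in> S"
      using S by (intro topological_tendstoD) auto
    moreover have "\<forall>\<^sub>F t in at_right 0. (t::real) \<in> {0<..<1}"
      by (rule eventually_at_right_real) simp
    ultimately show ?thesis
    proof eventually_elim
      case (elim t)
      then have "f (?l t) \<le> (1 - t) * f p + t * f y" using conv[of t] l by simp
      then show ?case using elim by (simp add: field_simps)
    qed
  qed
  ultimately show ?thesis by (rule tendsto_upperbound) simp
qed

text \<open>The base point comes second. For the log-partition function this is the relative entropy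
  of a single observation, with the expectation taken under the base point.\<close>

definition bregman :: "(real ^ 'n \<Rightarrow> real) \<Rightarrow> real ^ 'n \<Rightarrow> real ^ 'n \<Rightarrow> real" where
  "bregman f y x = f y - f x - gradient f x \<bullet> (y - x)"

section \<open>Tilted means and the Bregman divergence of the log-partition function\<close>

context exponential_family
begin

lemma A_differentiable: "\<theta> \<in> \<Theta> \<Longrightarrow> A differentiable (at \<theta>)"
  using A_smooth C_class_on.simps(2)[of 0] unfolding smooth_on_def by blast

lemma mean_of_integral:
  assumes "\<theta> \<in> \<Theta>" "\<psi> \<in> borel_measurable \<mu>"
  shows "mean_of Q X \<psi> \<theta> = (\<integral>x. exp_density h T A \<theta> x * \<psi> x \<partial>\<mu>)"
  unfolding mean_of_def
  by (rule distributed_integral[OF has_density[OF assms(1)] assms(2), symmetric])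
    (simp add: exp_density_def h_nonneg)

context
  fixes \<psi> :: "'x \<Rightarrow> real" and B :: real
  assumes \<psi>: "\<psi> \<in> borel_measurable \<mu>" and bound: "\<And>x. x \<in> space \<mu> \<Longrightarrow> \<bar>\<psi> x\<bar> \<le> B"
begin

lemma integrable_bounded_statistic:
  assumes "\<theta> \<in> \<Theta>"
  shows "integrable (Q \<theta>) (\<lambda>\<omega>. \<psi> (X 0 \<omega>))"
proof -
  interpret prob_space "Q \<theta>" using prob[OF assms] .
  have [measurable]: "X 0 \<in> measurable (Q \<theta>) \<mu>"
    using has_density[OF assms, of 0] by (simp add: distributed_def)
  note \<psi>[measurable]
  show ?thesis
    by (rule integrable_const_bound[of _ B]) (auto intro!: AE_I2 bound measurable_space[of "X 0" "Q \<theta>" \<mu>])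
qed

lemma integrable_density_mult:
  assumes "\<theta> \<in> \<Theta>"
  shows "integrable \<mu> (\<lambda>x. exp_density h T A \<theta> x * \<psi> x)"
  using distributed_integrable[OF has_density[OF assms] \<psi>] integrable_bounded_statistic[OF assms]
  by (simp add: exp_density_def h_nonneg)

lemma abs_mean_of_le:
  assumes "\<theta> \<in> \<Theta>"
  shows "\<bar>mean_of Q X \<psi> \<theta>\<bar> \<le> B"
proof -
  interpret prob_space "Q \<theta>" using prob[OF assms] .
  have "X 0 \<in> measurable (Q \<theta>) \<mu>"
    using has_density[OF assms, of 0] by (simp add: distributed_def)
  then have b: "\<bar>\<psi> (X 0 \<omega>)\<bar> \<le> B" if "\<omega> \<in> space (Q \<theta>)" for \<omega>
    using that by (intro bound measurable_space[of "X 0" "Q \<theta>" \<mu>])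
  have "mean_of Q X \<psi> \<theta> \<le> B" "- mean_of Q X \<psi> \<theta> \<le> B"
    unfolding mean_of_def integral_minus[symmetric]
    by (intro integral_le_const integrable_minus integrable_bounded_statistic assms AE_I2; use b in force)+
  then show ?thesis by simp
qed

lemma mean_of_shift:
  assumes "\<theta> \<in> \<Theta>"
  shows "mean_of Q X (\<lambda>x. c + \<psi> x) \<theta> = c + mean_of Q X \<psi> \<theta>"
    and "mean_of Q X (\<lambda>x. c - \<psi> x) \<theta> = c - mean_of Q X \<psi> \<theta>"
proof -
  interpret prob_space "Q \<theta>" using prob[OF assms] .
  show "mean_of Q X (\<lambda>x. c + \<psi> x) \<theta> = c + mean_of Q X \<psi> \<theta>"
    "mean_of Q X (\<lambda>x. c - \<psi> x) \<theta> = c - mean_of Q X \<psi> \<theta>"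
    by (simp_all add: mean_of_def integrable_bounded_statistic[OF assms] prob_space)
qed

text \<open>The factor \<open>exp (A \<theta>)\<close> cancels the normalization of the density, so
  \<open>G\<close> integrates \<open>exp (\<theta> \<bullet> (T x - v))\<close> against the
  nonnegative weight \<open>h x * \<psi> x\<close>, and convexity of \<open>exp\<close> passes
  through the integral. The intermediate point must lie in \<open>\<Theta>\<close> because
  \<open>A\<close> and \<open>Q\<close> carry no meaning elsewhere.\<close>

lemma tilted_mean_convex:
  fixes v :: "real ^ 'n"
  assumes nonneg: "\<And>x. x \<in> space \<mu> \<Longrightarrow> 0 \<le> \<psi> x"
    and \<theta>: "\<theta> \<in> \<Theta>" "\<theta>' \<in> \<Theta>" "(1 - t) *\<^sub>R \<theta> + t *\<^sub>R \<theta>' \<in> \<Theta>" and t: "0 \<le> t" "t \<le> 1"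
  defines "G \<equiv> \<lambda>\<theta>. exp (A \<theta> - \<theta> \<bullet> v) * mean_of Q X \<psi> \<theta>"
  shows "G ((1 - t) *\<^sub>R \<theta> + t *\<^sub>R \<theta>') \<le> (1 - t) * G \<theta> + t * G \<theta>'"
proof -
  let ?f = "\<lambda>\<theta> x. h x * exp (\<theta> \<bullet> (T x - v)) * \<psi> x"
  have f: "?f \<theta> x = exp (A \<theta> - \<theta> \<bullet> v) * (exp_density h T A \<theta> x * \<psi> x)" for \<theta> x
    by (simp add: exp_density_def inner_diff_right exp_diff)
  have int: "integrable \<mu> (?f \<theta>)" if "\<theta> \<in> \<Theta>" for \<theta>
    unfolding f by (rule integrable_mult_right) (rule integrable_density_mult[OF that])
  have G: "G \<theta> = (\<integral>x. ?f \<theta> x \<partial>\<mu>)" if "\<theta> \<in> \<Theta>" for \<theta>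
    unfolding f G_def mean_of_integral[OF that \<psi>] by simp
  have "?f ((1 - t) *\<^sub>R \<theta> + t *\<^sub>R \<theta>') x \<le> (1 - t) * ?f \<theta> x + t * ?f \<theta>' x" if x: "x \<in> space \<mu>" for x
  proof -
    have "exp (((1 - t) *\<^sub>R \<theta> + t *\<^sub>R \<theta>') \<bullet> (T x - v))
        \<le> (1 - t) * exp (\<theta> \<bullet> (T x - v)) + t * exp (\<theta>' \<bullet> (T x - v))"
      using convex_onD[OF exp_convex, of t "\<theta> \<bullet> (T x - v)" "\<theta>' \<bullet> (T x - v)"] t
      by (simp add: inner_add_left)
    then have "h x * \<psi> x * exp (((1 - t) *\<^sub>R \<theta> + t *\<^sub>R \<theta>') \<bullet> (T x - v))
        \<le> h x * \<psi> x * ((1 - t) * exp (\<theta> \<bullet> (T x - v)) + t * exp (\<theta>' \<bullet> (T x - v)))"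
      using h_nonneg[OF x] nonneg[OF x] by (intro mult_left_mono) auto
    then show ?thesis by (simp add: algebra_simps)
  qed
  then have "G ((1 - t) *\<^sub>R \<theta> + t *\<^sub>R \<theta>') \<le> (\<integral>x. (1 - t) * ?f \<theta> x + t * ?f \<theta>' x \<partial>\<mu>)"
    unfolding G[OF \<theta>(3)]
    by (intro integral_mono int \<theta> Bochner_Integration.integrable_add integrable_mult_right)
  also have "\<dots> = (1 - t) * G \<theta> + t * G \<theta>'"
    by (simp add: int \<theta> G)
  finally show ?thesis .
qed

lemma tangent_le_tilted_mean:
  assumes nonneg: "\<And>x. x \<in> space \<mu> \<Longrightarrow> 0 \<le> \<psi> x"
    and p: "p \<in> \<Theta>" and y: "y \<in> \<Theta>"
    and d: "(mean_of Q X \<psi> has_derivative (\<lambda>h. g \<bullet> h)) (at p)"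
  shows "g \<bullet> (y - p) \<le> exp (bregman A y p) * mean_of Q X \<psi> y - mean_of Q X \<psi> p"
proof -
  let ?v = "gradient A p" and ?m = "mean_of Q X \<psi>"
  let ?G = "\<lambda>\<theta>. exp (A \<theta> - \<theta> \<bullet> ?v) * ?m \<theta>"
  let ?e = "exp (A p - p \<bullet> ?v)"
  \<comment> \<open>The tilt by \<open>?v\<close> makes the exponential factor stationary at \<open>p\<close>.\<close>
  have "(?G has_derivative (\<lambda>h. ?e * (g \<bullet> h))) (at p)"
    using has_derivative_gradient[OF A_differentiable[OF p]] d
    by (auto intro!: derivative_eq_intros simp: inner_commute)
  from tangent_le_of_convex_at[OF open_params p this, of y]
  have "?e * (g \<bullet> (y - p)) \<le> ?G y - ?G p"
    using tilted_mean_convex[OF nonneg p y] by blast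
  \<comment> \<open>The ratio of the tilting factors at \<open>y\<close> and at \<open>p\<close> is
    \<open>exp (bregman A y p)\<close>.\<close>
  also have "?G y = ?e * (exp (bregman A y p) * ?m y)"
    by (simp add: bregman_def mult_exp_exp[symmetric] inner_diff_right inner_commute algebra_simps
        flip: exp_add mult.assoc)
  finally have "?e * (g \<bullet> (y - p)) \<le> ?e * (exp (bregman A y p) * ?m y - ?m p)"
    by (simp add: algebra_simps)
  then show ?thesis by simp
qed

end

lemma mean_of_one: "\<theta> \<in> \<Theta> \<Longrightarrow> mean_of Q X (\<lambda>_. 1) \<theta> = 1"
  using prob_space.prob_space[OF prob] by (simp add: mean_of_def)

text \<open>For \<open>\<psi> = 1\<close> the mean is constant on the open set
  \<open>\<Theta>\<close>, so its gradient vanishes and the tangent inequality reads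
  \<open>0 \<le> exp (bregman A y p) - 1\<close>.\<close>

lemma bregman_nonneg:
  assumes "p \<in> \<Theta>" "y \<in> \<Theta>"
  shows "0 \<le> bregman A y p"
proof -
  have "((\<lambda>_. 1) has_derivative (\<lambda>h. 0 \<bullet> h)) (at p)" by simp
  then have "(mean_of Q X (\<lambda>_. 1) has_derivative (\<lambda>h. 0 \<bullet> h)) (at p)"
    by (rule has_derivative_transform_within_open[OF _ open_params assms(1)]) (simp add: mean_of_one)
  from tangent_le_tilted_mean[OF _ _ _ assms this, of 1] show ?thesis
    by (simp add: mean_of_one assms)
qed

text \<open>With \<open>\<psi> = 1\<close> the tilted mean is a multiple of
  \<open>exp (bregman A _ p)\<close>. This function is convex along the segment and has its minimum
  1 at \<open>p\<close>, so no point in between exceeds the value at \<open>y\<close>.\<close>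

lemma bregman_segment_le:
  assumes "p \<in> \<Theta>" "y \<in> \<Theta>" "(1 - t) *\<^sub>R p + t *\<^sub>R y \<in> \<Theta>" "0 \<le> t" "t \<le> 1"
  shows "bregman A ((1 - t) *\<^sub>R p + t *\<^sub>R y) p \<le> bregman A y p"
proof -
  let ?w = "(1 - t) *\<^sub>R p + t *\<^sub>R y" and ?v = "gradient A p"
  let ?e = "exp (A p - p \<bullet> ?v)"
  have b: "exp (A z - z \<bullet> ?v) = ?e * exp (bregman A z p)" for z
    by (simp add: bregman_def inner_diff_right inner_commute flip: exp_add)
  have "exp (A ?w - ?w \<bullet> ?v) \<le> (1 - t) * ?e + t * exp (A y - y \<bullet> ?v)"
    using tilted_mean_convex[of "\<lambda>_. 1" 1, OF _ _ _ assms] assms by (simp add: mean_of_one)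
  then have "?e * exp (bregman A ?w p) \<le> ?e * ((1 - t) + t * exp (bregman A y p))"
    unfolding b[of ?w] b[of y] by (simp add: algebra_simps)
  then have "exp (bregman A ?w p) \<le> (1 - t) * 1 + t * exp (bregman A y p)"
    by simp
  also have "\<dots> \<le> (1 - t) * exp (bregman A y p) + t * exp (bregman A y p)"
    using bregman_nonneg[OF assms(1,2)] assms(4,5) by (intro add_mono mult_left_mono) auto
  finally show ?thesis by (simp add: algebra_simps)
qed

text \<open>The statistics \<open>B + \<phi>\<close> and \<open>B - \<phi>\<close> have opposite
  gradients, so their tangent inequalities bound the linear term from both sides; both means lie in
  \<open>[0, 2 * B]\<close>. The second estimate serves to bound the gradient itself.\<close>

lemma mean_of_remainder:
  assumes \<phi>: "\<phi> \<in> borel_measurable \<mu>" "\<And>x. x \<in> space \<mu> \<Longrightarrow> \<bar>\<phi> x\<bar> \<le> B"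
    and p: "p \<in> \<Theta>" and y: "y \<in> \<Theta>" and d: "mean_of Q X \<phi> differentiable (at p)"
  defines "m \<equiv> mean_of Q X \<phi>"
  shows "\<bar>m y - m p - gradient m p \<bullet> (y - p)\<bar> \<le> 2 * B * (exp (bregman A y p) - 1)"
    and "\<bar>gradient m p \<bullet> (y - p)\<bar> \<le> 2 * B * exp (bregman A y p)"
proof -
  let ?E = "exp (bregman A y p)" and ?g = "gradient m p"
  have dm: "(m has_derivative (\<lambda>h. ?g \<bullet> h)) (at p)"
    using d has_derivative_gradient unfolding m_def by blast
  have "((\<lambda>\<theta>. B + m \<theta>) has_derivative (\<lambda>h. ?g \<bullet> h)) (at p)"
    using dm by (auto intro!: derivative_eq_intros)
  then have "(mean_of Q X (\<lambda>x. B + \<phi> x) has_derivative (\<lambda>h. ?g \<bullet> h)) (at p)"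
    by (rule has_derivative_transform_within_open[OF _ open_params p])
      (simp add: mean_of_shift[OF \<phi>] m_def)
  from tangent_le_tilted_mean[OF _ _ _ p y this, of "2 * B"]
  have lo: "?g \<bullet> (y - p) \<le> ?E * (B + m y) - (B + m p)"
    using \<phi> by (force simp: mean_of_shift[OF \<phi>] p y m_def abs_le_iff)
  have "((\<lambda>\<theta>. B - m \<theta>) has_derivative (\<lambda>h. (- ?g) \<bullet> h)) (at p)"
    using dm by (auto intro!: derivative_eq_intros)
  then have "(mean_of Q X (\<lambda>x. B - \<phi> x) has_derivative (\<lambda>h. (- ?g) \<bullet> h)) (at p)"
    by (rule has_derivative_transform_within_open[OF _ open_params p])
      (simp add: mean_of_shift[OF \<phi>] m_def)
  from tangent_le_tilted_mean[OF _ _ _ p y this, of "2 * B"]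
  have hi: "(- ?g) \<bullet> (y - p) \<le> ?E * (B - m y) - (B - m p)"
    using \<phi> by (force simp: mean_of_shift[OF \<phi>] p y m_def abs_le_iff)
  have my: "\<bar>m y\<bar> \<le> B" and mp: "\<bar>m p\<bar> \<le> B"
    using abs_mean_of_le[OF \<phi>] p y unfolding m_def by auto
  have E: "0 \<le> ?E - 1" using bregman_nonneg[OF p y] by simp
  \<comment> \<open>Rearranged, \<open>lo\<close> and \<open>hi\<close> bound the linear term minus
    \<open>m y - m p\<close> by \<open>(?E - 1) * (B + m y)\<close>, and its negative by
    \<open>(?E - 1) * (B - m y)\<close>.\<close>
  have 1: "(?E - 1) * (B + m y) \<le> (?E - 1) * (2 * B)" "(?E - 1) * (B - m y) \<le> (?E - 1) * (2 * B)"
    using my E by (auto intro!: mult_left_mono)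
  then show "\<bar>m y - m p - ?g \<bullet> (y - p)\<bar> \<le> 2 * B * (?E - 1)"
    using lo hi by (simp add: abs_le_iff algebra_simps)
  have 2: "?E * (B + m y) \<le> ?E * (2 * B)" "?E * (B - m y) \<le> ?E * (2 * B)"
    using my by (auto intro!: mult_left_mono)
  then show "\<bar>?g \<bullet> (y - p)\<bar> \<le> 2 * B * ?E"
    using lo hi mp unfolding abs_le_iff inner_minus_left
    by (intro conjI; simp only: mult.commute[of "2 * B"]; linarith)
qed

text \<open>The data enter the log-likelihood through the constant \<open>h\<close>-part and the
  linear term in \<open>s\<close>. The former cancels in the difference, and stationarity at the
  interior maximizer replaces \<open>s\<close> by \<open>real N *\<^sub>R gradient A p\<close>.
  Positivity of \<open>h\<close> at the data keeps all logarithms finite.\<close>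

lemma divergence_eq_bregman:
  assumes mle: "is_mle \<Theta> (likelihood h T A N x) p" and pos: "\<And>n. n \<in> {1..N} \<Longrightarrow> h (x n) > 0"
    and y: "y \<in> \<Theta>"
  shows "divergence \<Theta> (likelihood h T A N x) y = ereal (real N * bregman A y p)"
proof -
  let ?L = "likelihood h T A N x"
  define s where "s = (\<Sum>n=1..N. T (x n))"
  define l where "l \<theta> = (\<Sum>n=1..N. ln (h (x n))) + \<theta> \<bullet> s - real N * A \<theta>" for \<theta>
  have p: "p \<in> \<Theta>" and max: "\<And>\<theta>. \<theta> \<in> \<Theta> \<Longrightarrow> ?L \<theta> \<le> ?L p"
    using mle by (auto simp: is_mle_def is_arg_max_linorder)
  have dpos: "exp_density h T A \<theta> (x n) > 0" if "n \<in> {1..N}" for n \<theta>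
    using pos[OF that] by (simp add: exp_density_def)
  have Lpos: "?L \<theta> > 0" for \<theta>
    unfolding likelihood_def by (intro prod_pos) (simp add: dpos)
  have l: "ln (?L \<theta>) = l \<theta>" for \<theta>
  proof -
    have "ln (?L \<theta>) = (\<Sum>n=1..N. ln (exp_density h T A \<theta> (x n)))"
      unfolding likelihood_def by (rule ln_prod) (simp, metis dpos less_irrefl)
    also have "\<dots> = (\<Sum>n=1..N. ln (h (x n)) + (\<theta> \<bullet> T (x n) - A \<theta>))"
    proof (rule sum.cong)
      fix n assume "n \<in> {1..N}"
      from pos[OF this] show "ln (exp_density h T A \<theta> (x n)) = ln (h (x n)) + (\<theta> \<bullet> T (x n) - A \<theta>)"
        by (simp add: exp_density_def ln_mult)
    qed simp
    finally show ?thesis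
      by (simp add: l_def s_def sum.distrib sum_subtractf inner_sum_right)
  qed
  have lmax: "l \<theta> \<le> l p" if "\<theta> \<in> \<Theta>" for \<theta>
    using max[OF that] Lpos unfolding l[symmetric] by simp
  \<comment> \<open>The bound variable \<open>h\<close> is a direction here, not the normalization
    function.\<close>
  have "(l has_derivative (\<lambda>h. h \<bullet> s - real N * (gradient A p \<bullet> h))) (at p)"
    unfolding l_def using has_derivative_gradient[OF A_differentiable[OF p]]
    by (auto intro!: derivative_eq_intros)
  from differential_zero_maxmin[OF p open_params this] lmax
  have "(\<lambda>h. h \<bullet> s - real N * (gradient A p \<bullet> h)) = (\<lambda>_. 0)" by blast
  from fun_cong[OF this, of "y - p"]
  have score: "(y - p) \<bullet> s = real N * (gradient A p \<bullet> (y - p))" by simp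
  have "(SUP \<theta>\<in>\<Theta>. ext_ln (?L \<theta>)) = ereal (l p)"
    by (rule SUP_eqI) (use p lmax in \<open>auto simp: ext_ln_def Lpos l\<close>)
  then have "divergence \<Theta> ?L y = ereal (l p - l y)"
    by (simp add: divergence_def ext_ln_def Lpos l)
  also have "l p - l y = real N * bregman A y p"
    using score by (simp add: l_def bregman_def algebra_simps)
  finally show ?thesis .
qed

end


subsection \<open>Suprema over nearly ellipsoidal sets\<close>

lemma pos_definite_matrix_inv:
  assumes "pos_definite H"
  shows "H *v (matrix_inv H *v g) = g"
proof -
  have "\<forall>v. H *v v = 0 \<longrightarrow> v = 0"
    using assms unfolding pos_definite_def by (metis inner_zero_right less_irrefl)
  then have "invertible H"
    by (simp add: invertible_left_inverse matrix_left_invertible_ker)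
  then have "H ** matrix_inv H = mat 1"
    unfolding invertible_def matrix_inv_def by (rule someI2_ex) simp
  then show ?thesis
    by (simp add: matrix_vector_mul_assoc)
qed

lemma pos_definite_symmetric: "pos_definite H \<Longrightarrow> u \<bullet> (H *v v) = v \<bullet> (H *v u)"
  by (metis dot_lmul_matrix inner_commute pos_definite_def transpose_matrix_vector)

lemma pos_definite_Cauchy_Schwarz:
  assumes H: "pos_definite H"
  shows "(w \<bullet> (H *v u))\<^sup>2 \<le> (w \<bullet> (H *v w)) * (u \<bullet> (H *v u))"
proof (cases "w = 0")
  case False
  define a where "a = w \<bullet> (H *v w)"
  define b where "b = w \<bullet> (H *v u)"
  define c where "c = u \<bullet> (H *v u)"
  have a: "a > 0" using H False by (simp add: a_def pos_definite_def)
  \<comment> \<open>What remains of \<open>u\<close> after its \<open>H\<close>-orthogonal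
    projection onto \<open>w\<close>; the claim is the nonnegativity of its quadratic form.\<close>
  define z where "z = u - (b / a) *\<^sub>R w"
  have "0 \<le> z \<bullet> (H *v z)"
    using H by (cases "z = 0") (auto simp: pos_definite_def intro: less_imp_le)
  also have "z \<bullet> (H *v z) = c - 2 * (b / a) * b + (b / a)\<^sup>2 * a"
    using pos_definite_symmetric[OF H, of u w]
    by (simp add: z_def a_def b_def c_def matrix_vector_mult_diff_distrib matrix_vector_mult_scaleR
        inner_diff_left inner_diff_right power2_eq_square algebra_simps)
  also have "\<dots> = c - b\<^sup>2 / a"
    using a by (simp add: field_simps power2_eq_square)
  finally show ?thesis
    using a by (simp add: field_simps flip: a_def b_def c_def)
qed simp

lemma sqrt_diff_le:
  assumes "0 \<le> b" "b \<le> a"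
  shows "sqrt a - sqrt b \<le> sqrt (a - b)"
  using sqrt_add_le_add_sqrt[of "a - b" b] assms by simp

text \<open>The upper bound comes from Cauchy-Schwarz on a slightly enlarged ellipsoid, the lower
  bound from an explicit point on a slightly shrunk one. The constant \<open>C\<close> depends only
  on \<open>l\<close>, \<open>K\<close>, \<open>G\<close> and \<open>B\<close>, which makes both
  bounds uniform in the centre \<open>p\<close>.\<close>

lemma constrained_sup_quadratic:
  fixes m D :: "real ^ 'n \<Rightarrow> real" and p g :: "real ^ 'n" and H :: "real ^ 'n ^ 'n"
  assumes H: "pos_definite H" and l: "l > 0" "\<And>v. l * (norm v)\<^sup>2 \<le> v \<bullet> (H *v v)"
    and r: "r > 0" "cball p r \<subseteq> S" and K: "K \<ge> 0" "K * r \<le> l / 4"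
    and taylor: "\<And>u. norm u \<le> r \<Longrightarrow> \<bar>D (p + u) - u \<bullet> (H *v u) / 2\<bar> \<le> K * norm u ^ 3"
    and far: "\<And>y. y \<in> S \<Longrightarrow> norm (y - p) > r \<Longrightarrow> l / 4 * r\<^sup>2 \<le> D y"
    and rem: "\<And>y. y \<in> S \<Longrightarrow> \<bar>m y - m p - g \<bullet> (y - p)\<bar> \<le> 2 * B * (exp (D y) - 1)"
    and B: "B \<ge> 0" and g: "norm g \<le> G" and e: "0 < e" "e \<le> 1" "e < l / 4 * r\<^sup>2"
  defines "V \<equiv> g \<bullet> (matrix_inv H *v g)"
    and "C \<equiv> G / sqrt l * sqrt (2 * (K * (2 / sqrt l) ^ 3)) + 4 * B"
  shows "\<And>y. y \<in> S \<Longrightarrow> D y \<le> e \<Longrightarrow> m y \<le> m p + sqrt (2 * e * V) + C * e powr (3/4)"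
    and "\<exists>y\<in>S. D y \<le> e \<and> m p + sqrt (2 * e * V) - C * e powr (3/4) \<le> m y"
proof -
  define a where "a = e powr (3/4)"
  define w where "w = matrix_inv H *v g"
  \<comment> \<open>On \<open>{D \<le> e}\<close> displacements have norm at most
    \<open>c * sqrt e\<close>, so the cubic Taylor error is at most
    \<open>J * sqrt e ^ 3 = J * a\<^sup>2\<close>; its square root is of order
    \<open>a\<close>.\<close>
  define c where "c = 2 / sqrt l"
  define J where "J = K * c ^ 3"
  have c: "c > 0" using l by (simp add: c_def)
  have J: "J \<ge> 0" using K c by (simp add: J_def)
  have a: "a > 0" using e by (simp add: a_def)
  have a2: "a\<^sup>2 = sqrt e ^ 3"
  proof -
    have "a\<^sup>2 = e powr (3/2)"
      using e by (simp add: a_def power2_eq_square flip: powr_add)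
    also have "\<dots> = (e powr (1/2)) powr 3" by (simp add: powr_powr)
    also have "\<dots> = sqrt e ^ 3" using e by (simp add: powr_half_sqrt)
    finally show ?thesis .
  qed
  have ea: "e \<le> a"
    using powr_mono'[of "3/4" 1 e] e by (simp add: a_def)
  have Hw: "H *v w = g" unfolding w_def by (rule pos_definite_matrix_inv[OF H])
  have V: "V = w \<bullet> (H *v w)" using Hw by (simp add: V_def w_def inner_commute)
  have V0: "V \<ge> 0" using l(2)[of w] l(1) unfolding V by (meson mult_nonneg_nonneg less_imp_le order_trans zero_le_power2)
  \<comment> \<open>Coercivity of \<open>H\<close> gives \<open>l * norm w \<le> norm g\<close>,
    hence \<open>V = w \<bullet> g \<le> (norm g)\<^sup>2 / l\<close>.\<close>
  have sV: "sqrt V \<le> G / sqrt l"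
  proof -
    have "l * V \<le> G\<^sup>2"
    proof (cases "w = 0")
      case False
      have "l * (norm w * norm w) \<le> norm w * norm g"
        using l(2)[of w] Cauchy_Schwarz_ineq2[of w g] Hw by (simp add: power2_eq_square)
      then have lw: "l * norm w \<le> norm g" using False by (simp add: mult.left_commute[of l])
      have "l * V \<le> l * (norm w * norm g)"
        using Cauchy_Schwarz_ineq2[of w g] Hw l(1) unfolding V by (intro mult_left_mono) auto
      also have "\<dots> \<le> norm g * norm g"
        using mult_right_mono[OF lw, of "norm g"] by (simp add: mult.assoc)
      also have "\<dots> \<le> G\<^sup>2"
        using g unfolding power2_eq_square by (intro mult_mono) (auto intro: order_trans[OF norm_ge_zero])
      finally show ?thesis .
    qed (simp add: V)
    then have "V \<le> (G / sqrt l)\<^sup>2"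
      using l(1) by (simp add: power_divide field_simps)
    moreover have "G / sqrt l \<ge> 0" using order_trans[OF norm_ge_zero g] l(1) by simp
    ultimately show ?thesis by (rule real_le_lsqrt[OF _ _ , rotated -1])
  qed
  \<comment> \<open>The two sources of error: the perturbed level of the ellipsoid, and the
    remainder of \<open>m\<close>, of order \<open>e \<le> a\<close>.\<close>
  have err: "sqrt V * (sqrt (2 * J) * a) + 4 * B * e \<le> C * a"
  proof -
    have "sqrt V * (sqrt (2 * J) * a) \<le> G / sqrt l * (sqrt (2 * J) * a)"
      using sV J a by (intro mult_right_mono) auto
    moreover have "4 * B * e \<le> 4 * B * a" using ea B by (intro mult_left_mono) auto
    ultimately show ?thesis by (simp add: C_def J_def c_def algebra_simps)
  qed
  have sJ: "sqrt (2 * (J * sqrt e ^ 3)) = sqrt (2 * J) * a"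
    using a by (simp add: real_sqrt_mult a2[symmetric])
  have rem_e: "\<bar>m y - m p - g \<bullet> (y - p)\<bar> \<le> 4 * B * e" if "y \<in> S" "D y \<le> e" for y
  proof -
    have "exp (D y) \<le> exp e" using that by simp
    also have "\<dots> \<le> 1 + e + e\<^sup>2" using e by (intro exp_bound) auto
    also have "\<dots> \<le> 1 + 2 * e" using e by (simp add: power2_eq_square mult_left_le)
    finally have "2 * B * (exp (D y) - 1) \<le> 2 * B * (2 * e)" using B by (intro mult_left_mono) auto
    then show ?thesis using rem[OF that(1)] by simp
  qed

  show "m y \<le> m p + sqrt (2 * e * V) + C * e powr (3/4)" if y: "y \<in> S" "D y \<le> e" for y
  proof -
    define u where "u = y - p"
    have ur: "norm u \<le> r" using far[OF y(1)] y(2) e(3) unfolding u_def by linarith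
    have D: "\<bar>D y - u \<bullet> (H *v u) / 2\<bar> \<le> K * norm u ^ 3"
      using taylor[OF ur] by (simp add: u_def)
    \<comment> \<open>By \<open>K * r \<le> l / 4\<close> the cubic error takes up at most half of
      the quadratic term \<open>l / 2 * (norm u)\<^sup>2\<close>, so \<open>D\<close> still grows
      quadratically.\<close>
    have "K * norm u ^ 3 \<le> l / 4 * (norm u)\<^sup>2"
    proof -
      have "K * norm u \<le> l / 4" using mult_left_mono[OF ur K(1)] K(2) by linarith
      from mult_right_mono[OF this, of "(norm u)\<^sup>2"] show ?thesis
        by (simp add: power2_eq_square power3_eq_cube mult.assoc)
    qed
    then have "l / 4 * (norm u)\<^sup>2 \<le> e" using D y(2) l(2)[of u] by linarith
    then have "(norm u)\<^sup>2 \<le> (c * sqrt e)\<^sup>2"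
      using l(1) e(1) by (simp add: c_def power_mult_distrib power_divide field_simps)
    then have "norm u \<le> c * sqrt e"
      by (rule power2_le_imp_le) (use c e in simp)
    then have "norm u ^ 3 \<le> (c * sqrt e) ^ 3" by (rule power_mono) simp
    then have "K * norm u ^ 3 \<le> J * sqrt e ^ 3"
      using K(1) by (simp add: J_def power_mult_distrib mult_left_mono mult.assoc)
    then have uHu: "u \<bullet> (H *v u) \<le> 2 * e + 2 * (J * sqrt e ^ 3)"
      using D y(2) by linarith
    have "(g \<bullet> u)\<^sup>2 \<le> V * (u \<bullet> (H *v u))"
      using pos_definite_Cauchy_Schwarz[OF H, of w u] pos_definite_symmetric[OF H, of w u] Hw
      by (simp add: V inner_commute)
    also have "\<dots> \<le> V * (2 * e + 2 * (J * sqrt e ^ 3))"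
      using uHu V0 by (rule mult_left_mono)
    finally have "g \<bullet> u \<le> sqrt (V * (2 * e + 2 * (J * sqrt e ^ 3)))"
      by (rule real_le_rsqrt)
    also have "\<dots> = sqrt V * sqrt (2 * e + 2 * (J * sqrt e ^ 3))"
      by (rule real_sqrt_mult)
    also have "\<dots> \<le> sqrt V * (sqrt (2 * e) + sqrt (2 * (J * sqrt e ^ 3)))"
      using e J V0 by (intro mult_left_mono sqrt_add_le_add_sqrt) auto
    also have "\<dots> = sqrt (2 * e * V) + sqrt V * (sqrt (2 * J) * a)"
      unfolding sJ by (simp add: real_sqrt_mult algebra_simps)
    finally show ?thesis
      using rem_e[OF y] err unfolding u_def a_def by linarith
  qed

  have Dp: "D p = 0" using taylor[of 0] r by simp
  have p: "p \<in> S" using r by auto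
  \<comment> \<open>In the degenerate case the main term is itself of the order of the error, so the centre will do.\<close>
  show "\<exists>y\<in>S. D y \<le> e \<and> m p + sqrt (2 * e * V) - C * e powr (3/4) \<le> m y"
  proof (cases "V = 0 \<or> e < J * sqrt e ^ 3")
    case True
    have "sqrt (2 * e * V) \<le> sqrt V * (sqrt (2 * J) * a)"
    proof (cases "V = 0")
      case False
      then have "2 * e * V \<le> V * (2 * (J * sqrt e ^ 3))" using True V0 by (simp add: mult.commute)
      then have "sqrt (2 * e * V) \<le> sqrt (V * (2 * (J * sqrt e ^ 3)))" by simp
      also have "\<dots> = sqrt V * (sqrt (2 * J) * a)" unfolding real_sqrt_mult[of V] sJ ..
      finally show ?thesis .
    qed simp
    moreover have "0 \<le> 4 * B * e" using B e by simp
    ultimately have "m p + sqrt (2 * e * V) - C * e powr (3/4) \<le> m p"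
      using err unfolding a_def by linarith
    then show ?thesis using p Dp e by (intro bexI[of _ p]) auto
  next
    case False
    then have Vpos: "V > 0" and eJ: "J * sqrt e ^ 3 \<le> e" using V0 by auto
    \<comment> \<open>The witness points along \<open>w\<close>, where Cauchy-Schwarz is an
      equality. Its length makes the quadratic part \<open>t\<^sup>2 / 2\<close> and the cubic
      allowance \<open>J * sqrt e ^ 3\<close> add up to exactly \<open>e\<close>.\<close>
    define t where "t = sqrt (2 * e - 2 * (J * sqrt e ^ 3))"
    define u where "u = (t / sqrt V) *\<^sub>R w"
    have t2: "t\<^sup>2 = 2 * e - 2 * (J * sqrt e ^ 3)" using eJ by (simp add: t_def)
    have uHu: "u \<bullet> (H *v u) = t\<^sup>2"
      using Vpos by (simp add: u_def matrix_vector_mult_scaleR V[symmetric] power2_eq_square)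
    have lu: "l * (norm u)\<^sup>2 \<le> 2 * e"
      using l(2)[of u] uHu t2 J e by (smt (verit) mult_nonneg_nonneg real_sqrt_ge_zero zero_le_power)
    have "(norm u)\<^sup>2 \<le> (c * sqrt e)\<^sup>2" "(norm u)\<^sup>2 \<le> r\<^sup>2"
    proof -
      have u4: "l * (norm u)\<^sup>2 \<le> 4 * e" using lu e by linarith
      then show "(norm u)\<^sup>2 \<le> (c * sqrt e)\<^sup>2"
        using l(1) e(1) by (simp add: c_def power_mult_distrib power_divide field_simps)
      have "l * (norm u)\<^sup>2 \<le> l * r\<^sup>2" using u4 e(3) by simp
      then show "(norm u)\<^sup>2 \<le> r\<^sup>2" using l(1) by simp
    qed
    then have uc: "norm u \<le> c * sqrt e" and ur: "norm u \<le> r"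
      using c e r by (auto intro: power2_le_imp_le)
    have "norm u ^ 3 \<le> (c * sqrt e) ^ 3" using uc by (rule power_mono) simp
    then have "K * norm u ^ 3 \<le> J * sqrt e ^ 3"
      using K(1) by (simp add: J_def power_mult_distrib mult_left_mono mult.assoc)
    then have De: "D (p + u) \<le> e"
      using taylor[OF ur] uHu t2 by linarith
    have S: "p + u \<in> S" using ur r by (auto simp: dist_norm)
    have "sqrt (2 * e * V) - sqrt V * (sqrt (2 * J) * a) = sqrt V * (sqrt (2 * e) - sqrt (2 * (J * sqrt e ^ 3)))"
      unfolding sJ by (simp add: real_sqrt_mult algebra_simps)
    also have "\<dots> \<le> sqrt V * t"
      unfolding t_def using eJ J V0 e by (intro mult_left_mono sqrt_diff_le) auto
    also have "\<dots> = g \<bullet> u"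
      using Vpos Hw V by (simp add: u_def inner_commute[of g] real_div_sqrt field_simps)
    finally have "m p + sqrt (2 * e * V) - C * e powr (3/4) \<le> m (p + u)"
      using rem_e[OF S De] err unfolding a_def by simp
    then show ?thesis using S De by blast
  qed
qed


text \<open>The quadratic form is continuous on the compact product of \<open>U\<close> with the
  unit sphere, so it attains its extrema there; the minimum is positive, and homogeneity extends
  both bounds to all vectors.\<close>

lemma pos_definite_uniform_bounds:
  fixes f :: "real ^ 'n \<Rightarrow> real"
  assumes f: "C_class_on 2 S f" and U: "U \<subseteq> S" "compact U"
    and pd: "\<And>x. x \<in> U \<Longrightarrow> pos_definite (hessian f x)"
  obtains l L where "l > 0" "\<And>x v. x \<in> U \<Longrightarrow> l * (norm v)\<^sup>2 \<le> v \<bullet> (hessian f x *v v)"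
    "\<And>x v. x \<in> U \<Longrightarrow> v \<bullet> (hessian f x *v v) \<le> L * (norm v)\<^sup>2"
proof (cases "U = {}")
  case False
  let ?q = "\<lambda>(x, v). v \<bullet> (hessian f x *v v)"
  let ?W = "U \<times> sphere (0 :: real ^ 'n) 1"
  have "axis undefined 1 \<in> sphere (0 :: real ^ 'n) 1" by simp
  then have ne: "?W \<noteq> {}" using False by blast
  have cW: "compact ?W" using U by (intro compact_Times) auto
  have "continuous_on ?W (\<lambda>z. snd z $ i)" for i
    by (intro continuous_intros)
  moreover have "continuous_on ?W (\<lambda>z. hessian f (fst z) $ i $ j)" for i j
    by (rule continuous_on_compose2[OF C_class_on_2_continuous_hessian[OF f U(1)] continuous_on_fst[OF continuous_on_id]])
      auto
  ultimately have "continuous_on ?W (\<lambda>z. \<Sum>i\<in>UNIV. snd z $ i * (\<Sum>j\<in>UNIV. hessian f (fst z) $ i $ j * snd z $ j))"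
    by (intro continuous_on_sum continuous_on_mult)
  then have cont: "continuous_on ?W ?q"
    by (simp add: case_prod_unfold inner_vec_def matrix_vector_mult_def)
  obtain z where z: "z \<in> ?W" "\<And>w. w \<in> ?W \<Longrightarrow> ?q z \<le> ?q w"
    using continuous_attains_inf[OF cW ne cont] by blast
  obtain z' where z': "z' \<in> ?W" "\<And>w. w \<in> ?W \<Longrightarrow> ?q w \<le> ?q z'"
    using continuous_attains_sup[OF cW ne cont] by blast
  have scale: "v \<bullet> (hessian f x *v v) = ?q (x, v /\<^sub>R norm v) * (norm v)\<^sup>2" for x v
    by (cases "v = 0") (simp_all add: matrix_vector_mult_scaleR power2_eq_square field_simps)
  have W: "(x, v /\<^sub>R norm v) \<in> ?W" if "x \<in> U" "v \<noteq> 0" for x v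
    using that by simp
  show ?thesis
  proof (rule that[of "?q z" "?q z'"])
    have "fst z \<in> U" "snd z \<noteq> 0" using z(1) by auto
    then show "?q z > 0" using pd by (simp add: case_prod_unfold pos_definite_def)
    fix x v assume x: "x \<in> U"
    show "?q z * (norm v)\<^sup>2 \<le> v \<bullet> (hessian f x *v v)"
    proof (cases "v = 0")
      case False
      then show ?thesis unfolding scale[of v x] using z(2)[OF W[OF x False]] by (intro mult_right_mono) auto
    qed simp
    show "v \<bullet> (hessian f x *v v) \<le> ?q z' * (norm v)\<^sup>2"
    proof (cases "v = 0")
      case False
      then show ?thesis unfolding scale[of v x] using z'(2)[OF W[OF x False]] by (intro mult_right_mono) auto
    qed simp
  qed
qed (use that[of 1] in simp)

subsection \<open>Expansion of the DR-expectation\<close>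

text \<open>The penalty is 0 where \<open>d y \<le> k\<close> and turns every other term into
  \<open>-\<infinity>\<close>, so an upper bound on the sublevel set and one good point in it
  enclose the supremum.\<close>

lemma dr_expectation_bounds:
  assumes div: "\<And>y. y \<in> \<Theta> \<Longrightarrow> divergence \<Theta> L y = ereal (d y)" and k: "k > 0"
    and upper: "\<And>y. y \<in> \<Theta> \<Longrightarrow> d y \<le> k \<Longrightarrow> m y \<le> c + b"
    and lower: "\<exists>y\<in>\<Theta>. d y \<le> k \<and> c - b \<le> m y"
  shows "\<bar>dr_expectation k \<Theta> L m - ereal c\<bar> \<le> ereal b"
proof -
  have pen: "ereal (m y) - pow_infinity (ereal (1 / k) * divergence \<Theta> L y) = (if d y \<le> k then ereal (m y) else -\<infinity>)"
    if "y \<in> \<Theta>" for y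
    using k by (simp add: div[OF that] pow_infinity_def one_ereal_def field_simps)
  have "dr_expectation k \<Theta> L m \<le> ereal (c + b)"
    unfolding dr_expectation_def by (rule SUP_least) (simp add: pen upper del: plus_ereal.simps)
  moreover obtain y where y: "y \<in> \<Theta>" "d y \<le> k" "c - b \<le> m y" using lower by blast
  then have "ereal (c - b) \<le> dr_expectation k \<Theta> L m"
    unfolding dr_expectation_def by (intro SUP_upper2[of y]) (simp_all add: pen)
  ultimately show ?thesis
    by (cases "dr_expectation k \<Theta> L m") (auto simp: abs_le_iff)
qed

section \<open>Expansion uniform over maximizers near the true parameter\<close>

context exponential_family
begin

text \<open>A deterministic statement: every constant comes from a fixed ball around
  \<open>\<theta>\<close>, so the bound holds for all data whose maximizer is close to
  \<open>\<theta>\<close>. Probability then enters only through the exceptional events.\<close>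

lemma dr_expectation_expansion:
  assumes pd: "\<forall>\<theta>\<in>\<Theta>. pos_definite (hessian A \<theta>)"
    and \<phi>_meas: "\<phi> \<in> borel_measurable \<mu>" and \<phi>_bound: "\<forall>x\<in>space \<mu>. \<bar>\<phi> x\<bar> \<le> B"
    and k: "k > 0" and \<theta>: "\<theta> \<in> \<Theta>"
  defines "m \<equiv> mean_of Q X \<phi>"
  assumes dm: "\<forall>\<theta>\<in>\<Theta>. m differentiable (at \<theta>)"
  shows "\<exists>\<epsilon>>0. \<exists>C N0. \<forall>N\<ge>N0. \<forall>x p. is_mle \<Theta> (likelihood h T A N x) p \<longrightarrow> dist p \<theta> \<le> \<epsilon> \<longrightarrow>
    (\<forall>n\<in>{1..N}. h (x n) > 0) \<longrightarrow>
      \<bar>dr_expectation k \<Theta> (likelihood h T A N x) m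
        - ereal (m p + sqrt (2 * k / real N * asym_variance A m p))\<bar> \<le> ereal (C * real N powr (- 3 / 4))"
proof -
  note \<phi> = \<phi>_meas \<phi>_bound[rule_format]
  obtain R where R: "R > 0" "cball \<theta> R \<subseteq> \<Theta>"
    using open_params \<theta> open_contains_cball by blast
  have A3: "C_class_on 3 \<Theta> A" and A2: "C_class_on 2 \<Theta> A" using A_smooth by (auto simp: smooth_on_def)
  obtain K where K: "K \<ge> 0" and taylor: "\<And>x y. x \<in> cball \<theta> R \<Longrightarrow> y \<in> cball \<theta> R \<Longrightarrow>
      \<bar>bregman A y x - (y - x) \<bullet> (hessian A x *v (y - x)) / 2\<bar> \<le> K * norm (y - x) ^ 3"
    using C_class_on_3_taylor[OF A3 R(2)] unfolding bregman_def by blast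
  obtain l L where l: "l > 0" "\<And>x v. x \<in> cball \<theta> R \<Longrightarrow> l * (norm v)\<^sup>2 \<le> v \<bullet> (hessian A x *v v)"
    "\<And>x v. x \<in> cball \<theta> R \<Longrightarrow> v \<bullet> (hessian A x *v v) \<le> L * (norm v)\<^sup>2"
    using pos_definite_uniform_bounds[OF A2 R(2) compact_cball] pd R(2) by (metis subsetD)
  \<comment> \<open>With \<open>r \<le> R / 2\<close>, balls of radius \<open>r\<close> around
    points within \<open>R / 2\<close> of \<open>\<theta>\<close> stay in
    \<open>cball \<theta> R\<close>. The \<open>K + 1\<close> avoids a zero denominator.\<close>
  define r where "r = min (R / 2) (l / (4 * (K + 1)))"
  have r: "r > 0" using R l K by (simp add: r_def)
  have rR: "r \<le> R / 2" unfolding r_def by (rule min.cobounded1)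
  have "K * r \<le> (K + 1) * r" using r by simp
  also have "\<dots> \<le> (K + 1) * (l / (4 * (K + 1)))" using K by (intro mult_left_mono) (auto simp: r_def)
  also have "\<dots> = l / 4" using K by (simp add: field_simps)
  finally have Kr: "K * r \<le> l / 4" .
  \<comment> \<open>The gradient bound arises at distance \<open>r\<close> from the maximizer, where
    the divergence is at most \<open>L * r\<^sup>2 / 2 + K * r ^ 3\<close>.\<close>
  define G where "G = 2 * B * exp (L * r\<^sup>2 / 2 + K * r ^ 3) / r"
  define C where "C = (G / sqrt l * sqrt (2 * (K * (2 / sqrt l) ^ 3)) + 4 * B) * k powr (3/4)"
  \<comment> \<open>From here on the level \<open>k / N\<close> is below both 1 and
    \<open>l / 4 * r\<^sup>2\<close>; the \<open>Suc\<close> makes the inequalities strict and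
    \<open>N\<close> positive.\<close>
  define N0 where "N0 = Suc (nat \<lceil>max k (k / (l / 4 * r\<^sup>2))\<rceil>)"
  have B: "B \<ge> 0" using abs_mean_of_le[OF \<phi> \<theta>] by linarith
  show ?thesis
  proof (rule exI[of _ "R / 2"], rule conjI, use R in simp, rule exI[of _ C], rule exI[of _ N0],
      intro allI impI)
    fix N x p
    assume N: "N \<ge> N0" and mle: "is_mle \<Theta> (likelihood h T A N x) p" and near: "dist p \<theta> \<le> R / 2"
      and "\<forall>n\<in>{1..N}. h (x n) > 0"
    then have pos: "\<And>n. n \<in> {1..N} \<Longrightarrow> h (x n) > 0" by blast
    have p: "p \<in> \<Theta>" using mle by (simp add: is_mle_def is_arg_max_def)
    have sub: "cball p r \<subseteq> cball \<theta> R"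
    proof
      fix z assume "z \<in> cball p r"
      then show "z \<in> cball \<theta> R"
        using near rR dist_triangle[of \<theta> z p] by (simp add: dist_commute)
    qed
    have pR: "p \<in> cball \<theta> R" using near R by (simp add: dist_commute)
    let ?D = "\<lambda>y. bregman A y p"
    have taylor_p: "\<bar>?D (p + u) - u \<bullet> (hessian A p *v u) / 2\<bar> \<le> K * norm u ^ 3" if "norm u \<le> r" for u
      using taylor[OF pR, of "p + u"] sub that by (auto simp: subset_iff dist_norm)
    have far: "l / 4 * r\<^sup>2 \<le> ?D y" if y: "y \<in> \<Theta>" "norm (y - p) > r" for y
    proof -
      \<comment> \<open>\<open>bregman A _ p\<close> is monotone along the segment from \<open>p\<close> to \<open>y\<close>, where it crosses the sphere.\<close>
      define t where "t = r / norm (y - p)"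
      have yp: "y \<noteq> p" using y(2) r by auto
      then have t: "0 \<le> t" "t \<le> 1" using y(2) r by (simp_all add: t_def divide_le_eq_1)
      define u where "u = t *\<^sub>R (y - p)"
      have nu: "norm u = r" using yp r by (simp add: u_def t_def)
      have w: "(1 - t) *\<^sub>R p + t *\<^sub>R y = p + u" by (simp add: u_def algebra_simps)
      have "p + u \<in> \<Theta>" using sub R nu by (auto simp: subset_iff dist_norm)
      then have "?D (p + u) \<le> ?D y"
        using bregman_segment_le[OF p y(1) _ t] unfolding w by blast
      moreover have "K * norm u ^ 3 \<le> l / 4 * r\<^sup>2"
        using mult_right_mono[OF Kr, of "r\<^sup>2"] by (simp add: nu power2_eq_square power3_eq_cube mult.assoc)
      ultimately show ?thesis
        using taylor_p[of u] l(2)[OF pR, of u] by (simp add: nu)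
    qed
    have g: "norm (gradient m p) \<le> G"
    proof (cases "gradient m p = 0")
      case True
      then show ?thesis using B r by (simp add: G_def)
    next
      case False
      let ?g = "gradient m p"
      \<comment> \<open>Displacement by \<open>r\<close> in the direction of the gradient, so that
        the linear term equals \<open>r * norm ?g\<close>.\<close>
      define u where "u = (r / norm ?g) *\<^sub>R ?g"
      have nu: "norm u = r" using False r by (simp add: u_def)
      have y: "p + u \<in> \<Theta>" using sub R nu by (auto simp: subset_iff dist_norm)
      have "r * norm ?g = \<bar>?g \<bullet> (p + u - p)\<bar>"
        using False r by (simp add: u_def power2_norm_eq_inner[symmetric] power2_eq_square)
      also have "\<dots> \<le> 2 * B * exp (?D (p + u))"
        using mean_of_remainder(2)[OF \<phi> p y] bspec[OF dm p] unfolding m_def by blast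
      also have "\<dots> \<le> 2 * B * exp (L * r\<^sup>2 / 2 + K * r ^ 3)"
        using taylor_p[of u] l(3)[OF pR, of u] B by (intro mult_left_mono) (auto simp: nu)
      finally show ?thesis using r by (simp add: G_def field_simps)
    qed
    define e where "e = k / real N"
    have "real N > max k (k / (l / 4 * r\<^sup>2))"
      using N unfolding N0_def by linarith
    then have N1: "real N > k" "real N > k / (l / 4 * r\<^sup>2)" by auto
    have Np: "real N > 0" using N1 k by linarith
    have e: "0 < e" "e \<le> 1" using N1 k Np by (auto simp: e_def)
    have "k < real N * (l / 4 * r\<^sup>2)"
      using N1(2) l r by (simp add: pos_divide_less_eq)
    then have e3: "e < l / 4 * r\<^sup>2" using Np by (simp add: e_def pos_divide_less_eq mult.commute)
    have "real N powr (- 3 / 4) = 1 / real N powr (3 / 4)"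
      using powr_minus_divide[of "real N" "3 / 4"] by simp
    moreover have "e powr (3/4) = k powr (3/4) / real N powr (3/4)"
      unfolding e_def using k Np by (simp add: powr_divide)
    ultimately have Ce: "(G / sqrt l * sqrt (2 * (K * (2 / sqrt l) ^ 3)) + 4 * B) * e powr (3/4)
        = C * real N powr (- 3 / 4)"
      by (simp only: C_def times_divide_eq_right mult_1_right)
    have rem: "\<bar>m y - m p - gradient m p \<bullet> (y - p)\<bar> \<le> 2 * B * (exp (?D y) - 1)" if "y \<in> \<Theta>" for y
      using mean_of_remainder(1)[OF \<phi> p that] bspec[OF dm p] unfolding m_def by blast
    note bounds = constrained_sup_quadratic[where D = ?D and m = m and p = p and g = "gradient m p"
        and H = "hessian A p" and S = \<Theta>, OF bspec[OF pd p] l(1) l(2)[OF pR] r order_trans[OF sub R(2)]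
        K Kr taylor_p far rem B g e e3]
    have Dk: "real N * ?D y \<le> k \<longleftrightarrow> ?D y \<le> e" for y
      using Np by (simp add: e_def pos_le_divide_eq mult.commute)
    have e2: "2 * k / real N = 2 * e" by (simp add: e_def)
    show "\<bar>dr_expectation k \<Theta> (likelihood h T A N x) m
        - ereal (m p + sqrt (2 * k / real N * asym_variance A m p))\<bar> \<le> ereal (C * real N powr (- 3 / 4))"
      unfolding e2
    proof (rule dr_expectation_bounds[where d = "\<lambda>y. real N * ?D y"])
      show "divergence \<Theta> (likelihood h T A N x) y = ereal (real N * ?D y)" if "y \<in> \<Theta>" for y
        using divergence_eq_bregman[OF mle pos that] .
      show "k > 0" by (rule k)
    next
      fix y assume "y \<in> \<Theta>" "real N * ?D y \<le> k"
      then show "m y \<le> m p + sqrt (2 * e * asym_variance A m p) + C * real N powr (- 3 / 4)"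
        using bounds(1)[of y] unfolding Dk asym_variance_def Ce by blast
    next
      show "\<exists>y\<in>\<Theta>. real N * ?D y \<le> k \<and>
          m p + sqrt (2 * e * asym_variance A m p) - C * real N powr (- 3 / 4) \<le> m y"
        using bounds(2) unfolding Dk asym_variance_def Ce by blast
    qed
  qed
qed

text \<open>The density vanishes wherever \<open>h\<close> does, so each observation avoids that set
  almost surely, and countably many null sets remain null. This supplies the positivity required for
  the divergence formula.\<close>

lemma outer_measure_h_zero:
  assumes \<theta>: "\<theta> \<in> \<Theta>"
  shows "outer_measure_of (Q \<theta>) {\<omega> \<in> space (Q \<theta>). \<exists>n. h (X n \<omega>) \<le> 0} = 0"
proof -
  have X: "X n \<in> measurable (Q \<theta>) \<mu>" for n
    using has_density[OF \<theta>, of n] by (simp add: distributed_def)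
  have null: "X n -` {x \<in> space \<mu>. h x \<le> 0} \<inter> space (Q \<theta>) \<in> null_sets (Q \<theta>)" for n
  proof -
    note h_measurable[measurable]
    have S: "{x \<in> space \<mu>. h x \<le> 0} \<in> sets \<mu>" by measurable
    have "emeasure (Q \<theta>) (X n -` {x \<in> space \<mu>. h x \<le> 0} \<inter> space (Q \<theta>))
        = (\<integral>\<^sup>+x. ennreal (exp_density h T A \<theta> x) * indicator {x \<in> space \<mu>. h x \<le> 0} x \<partial>\<mu>)"
      by (rule distributed_emeasure[OF has_density[OF \<theta>] S])
    also have "\<dots> = (\<integral>\<^sup>+x. 0 \<partial>\<mu>)"
      by (intro nn_integral_cong)
        (auto simp: indicator_def exp_density_def ennreal_eq_0_iff mult_nonpos_nonneg)
    finally show ?thesis using measurable_sets[OF X S] by auto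
  qed
  have "{\<omega> \<in> space (Q \<theta>). \<exists>n. h (X n \<omega>) \<le> 0} = (\<Union>n. X n -` {x \<in> space \<mu>. h x \<le> 0} \<inter> space (Q \<theta>))"
    using measurable_space[OF X] by auto
  also have "\<dots> \<in> null_sets (Q \<theta>)" using null by blast
  finally show ?thesis by (simp add: null_setsD1 null_setsD2)
qed

end

subsection \<open>Boundedness in probability\<close>

text \<open>Subsets of the space have measurable covers attaining the outer measure, which reduces
  the claim to subadditivity. For other sets the infimum runs over an empty family, so the
  right-hand side is \<open>top\<close>.\<close>

lemma outer_measure_of_Un_le:
  "outer_measure_of M (A \<union> B) \<le> outer_measure_of M A + outer_measure_of M B"
proof (cases "A \<subseteq> space M \<and> B \<subseteq> space M")
  case True
  then obtain E F where E: "E \<in> sets M" "A \<subseteq> E" "outer_measure_of M A = emeasure M E"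
    and F: "F \<in> sets M" "B \<subseteq> F" "outer_measure_of M B = emeasure M F"
    using outer_measure_of_attain by metis
  have "outer_measure_of M (A \<union> B) \<le> outer_measure_of M (E \<union> F)"
    using E F by (intro outer_measure_of_mono) auto
  also have "\<dots> \<le> emeasure M E + emeasure M F"
    using E F by (simp add: emeasure_subadditive sets.Un)
  finally show ?thesis using E F by simp
next
  case False
  then have "{E \<in> sets M. A \<subseteq> E} = {} \<or> {E \<in> sets M. B \<subseteq> E} = {}"
    using sets.sets_into_space by blast
  then have "outer_measure_of M A = top \<or> outer_measure_of M B = top"
    unfolding outer_measure_of_def by (metis (no_types, lifting) image_empty Inf_empty)
  then show ?thesis by auto
qed

text \<open>For every \<open>M \<ge> C\<close> the event in question is eventually contained in
  \<open>E N\<close>, so the limsup is exactly 0 from \<open>C\<close> onwards.\<close>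

lemma bigO_probI:
  assumes bound: "\<And>N \<omega>. N \<ge> n \<Longrightarrow> \<omega> \<in> space P \<Longrightarrow> \<omega> \<notin> E N \<Longrightarrow> \<bar>Y N \<omega>\<bar> \<le> ereal (C * g N)"
    and g: "\<And>N. N \<ge> n \<Longrightarrow> g N > 0"
    and E: "(\<lambda>N. outer_measure_of P (E N)) \<longlonglongrightarrow> 0"
  shows "bigO_prob P Y g"
  unfolding bigO_prob_def
proof (rule tendsto_eventually)
  have "limsup (\<lambda>N. outer_measure_of P {\<omega> \<in> space P. \<bar>Y N \<omega> / ereal (g N)\<bar> > ereal M}) = 0"
    if M: "M \<ge> C" for M
  proof -
    have "outer_measure_of P {\<omega> \<in> space P. \<bar>Y N \<omega> / ereal (g N)\<bar> > ereal M} \<le> outer_measure_of P (E N)"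
      if N: "N \<ge> n" for N
    proof (intro outer_measure_of_mono subsetI, rule ccontr)
      fix \<omega> assume \<omega>: "\<omega> \<in> {\<omega> \<in> space P. \<bar>Y N \<omega> / ereal (g N)\<bar> > ereal M}" and nE: "\<omega> \<notin> E N"
      have b: "\<bar>Y N \<omega>\<bar> \<le> ereal (C * g N)" using bound[OF N _ nE] \<omega> by blast
      \<comment> \<open>The bound rules out infinite values, so the quotient can be treated in the
        reals.\<close>
      then obtain y where y: "Y N \<omega> = ereal y" by (cases "Y N \<omega>") auto
      have "M < \<bar>y\<bar> / g N" using \<omega> g[OF N] by (simp add: y)
      moreover have "\<bar>y\<bar> / g N \<le> C" using b g[OF N] by (simp add: y pos_divide_le_eq)
      ultimately show False using M by simp
    qed
    then have "\<forall>\<^sub>F N in sequentially. outer_measure_of P {\<omega> \<in> space P. \<bar>Y N \<omega> / ereal (g N)\<bar> > ereal M}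
        \<le> outer_measure_of P (E N)"
      unfolding eventually_sequentially by blast
    then have "limsup (\<lambda>N. outer_measure_of P {\<omega> \<in> space P. \<bar>Y N \<omega> / ereal (g N)\<bar> > ereal M})
        \<le> limsup (\<lambda>N. outer_measure_of P (E N))"
      by (rule Limsup_mono)
    also have "\<dots> = 0" using E by (intro lim_imp_Limsup) auto
    finally show ?thesis by simp
  qed
  then show "\<forall>\<^sub>F M in at_top.
      limsup (\<lambda>N. outer_measure_of P {\<omega> \<in> space P. \<bar>Y N \<omega> / ereal (g N)\<bar> > ereal M}) = 0"
    unfolding eventually_at_top_linorder by blast
qed

theorem theorem5:
  fixes \<Theta> :: "(real ^ 'n) set"
    and \<mu> :: "'x measure"
    and h :: "'x \<Rightarrow> real"
    and T :: "'x \<Rightarrow> real ^ 'n"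
    and A :: "real ^ 'n \<Rightarrow> real"
    and Q :: "real ^ 'n \<Rightarrow> 'w measure"
    and X :: "nat \<Rightarrow> 'w \<Rightarrow> 'x"
    and \<theta>hat :: "nat \<Rightarrow> 'w \<Rightarrow> real ^ 'n"
    and \<phi> :: "'x \<Rightarrow> real"
    and k :: real
  assumes "exponential_family \<Theta> \<mu> h T A Q X"
    and "\<forall>\<theta>\<in>\<Theta>. pos_definite (hessian A \<theta>)"
    and "consistent_mle \<Theta> h T A Q X \<theta>hat"
    and "k > 0"
    and "\<phi> \<in> borel_measurable \<mu>"
    and "bounded (\<phi> ` space \<mu>)"
    and "twice_differentiable_on \<Theta> (mean_of Q X \<phi>)"
  shows "\<forall>\<theta>\<in>\<Theta>. bigO_prob (Q \<theta>)
           (\<lambda>N \<omega>. dr_expectation k \<Theta> (likelihood h T A N (\<lambda>n. X n \<omega>)) (mean_of Q X \<phi>)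
              - ereal (mean_of Q X \<phi> (\<theta>hat N \<omega>)
                  + sqrt (2 * k / real N * asym_variance A (mean_of Q X \<phi>) (\<theta>hat N \<omega>))))
           (\<lambda>N. real N powr (- 3 / 4))"
proof
  fix \<theta> assume \<theta>: "\<theta> \<in> \<Theta>"
  interpret exponential_family \<Theta> \<mu> h T A Q X by fact
  let ?L = "\<lambda>N \<omega>. likelihood h T A N (\<lambda>n. X n \<omega>)"
  obtain B where B: "\<forall>x\<in>space \<mu>. \<bar>\<phi> x\<bar> \<le> B"
    using assms(6) by (auto simp: bounded_iff)
  have dm: "\<forall>\<theta>\<in>\<Theta>. mean_of Q X \<phi> differentiable (at \<theta>)"
    using assms(7) by (simp add: twice_differentiable_on_def)
  obtain \<epsilon> C N0 where \<epsilon>: "\<epsilon> > 0" and expand: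
    "\<forall>N\<ge>N0. \<forall>x p. is_mle \<Theta> (likelihood h T A N x) p \<longrightarrow> dist p \<theta> \<le> \<epsilon> \<longrightarrow>
      (\<forall>n\<in>{1..N}. h (x n) > 0) \<longrightarrow>
      \<bar>dr_expectation k \<Theta> (likelihood h T A N x) (mean_of Q X \<phi>)
        - ereal (mean_of Q X \<phi> p + sqrt (2 * k / real N * asym_variance A (mean_of Q X \<phi>) p))\<bar>
      \<le> ereal (C * real N powr (- 3 / 4))"
    using dr_expectation_expansion[OF assms(2,5) B assms(4) \<theta> dm] by (elim exE conjE)
  \<comment> \<open>The exceptional events: no maximizer exists, the estimate is far from
    \<open>\<theta>\<close>, or some observation has \<open>h = 0\<close>. Outside them the
    deterministic expansion applies at \<open>\<theta>hat N \<omega>\<close>.\<close>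
  define E1 where "E1 N = {\<omega> \<in> space (Q \<theta>). \<not> (\<exists>\<theta>'. is_mle \<Theta> (?L N \<omega>) \<theta>')}" for N
  define E2 where "E2 N = {\<omega> \<in> space (Q \<theta>). dist (\<theta>hat N \<omega>) \<theta> > \<epsilon>}" for N
  define E3 where "E3 = {\<omega> \<in> space (Q \<theta>). \<exists>n. h (X n \<omega>) \<le> 0}"
  have mle: "is_mle \<Theta> (?L N \<omega>) (\<theta>hat N \<omega>)" if "\<omega> \<in> space (Q \<theta>)" "\<omega> \<notin> E1 N" for N \<omega>
    using assms(3) \<theta> that unfolding consistent_mle_def Let_def E1_def by blast
  have E1: "(\<lambda>N. outer_measure_of (Q \<theta>) (E1 N)) \<longlonglongrightarrow> 0"
    and E2: "(\<lambda>N. outer_measure_of (Q \<theta>) (E2 N)) \<longlonglongrightarrow> 0"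
    using assms(3) \<theta> \<epsilon> unfolding consistent_mle_def Let_def E1_def E2_def by blast+
  show "bigO_prob (Q \<theta>)
           (\<lambda>N \<omega>. dr_expectation k \<Theta> (likelihood h T A N (\<lambda>n. X n \<omega>)) (mean_of Q X \<phi>)
              - ereal (mean_of Q X \<phi> (\<theta>hat N \<omega>)
                  + sqrt (2 * k / real N * asym_variance A (mean_of Q X \<phi>) (\<theta>hat N \<omega>))))
           (\<lambda>N. real N powr (- 3 / 4))"
  \<comment> \<open>Starting at \<open>Suc N0\<close> excludes \<open>N = 0\<close>, where
    \<open>0 powr (- 3 / 4)\<close> is 0 and the rate would not be positive.\<close>
  proof (rule bigO_probI[where n = "Suc N0" and E = "\<lambda>N. (E1 N \<union> E2 N) \<union> E3"])
    fix N \<omega> assume N: "Suc N0 \<le> N" and \<omega>: "\<omega> \<in> space (Q \<theta>)" "\<omega> \<notin> E1 N \<union> E2 N \<union> E3"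
    show "\<bar>dr_expectation k \<Theta> (?L N \<omega>) (mean_of Q X \<phi>)
        - ereal (mean_of Q X \<phi> (\<theta>hat N \<omega>)
            + sqrt (2 * k / real N * asym_variance A (mean_of Q X \<phi>) (\<theta>hat N \<omega>)))\<bar>
      \<le> ereal (C * real N powr (- 3 / 4))"
      by (rule expand[rule_format]) (use N \<omega> mle in \<open>auto simp: E2_def E3_def not_le\<close>)
  next
    have "(\<lambda>N. outer_measure_of (Q \<theta>) (E1 N) + outer_measure_of (Q \<theta>) (E2 N)
        + outer_measure_of (Q \<theta>) E3) \<longlonglongrightarrow> 0 + 0 + 0"
      unfolding E3_def outer_measure_h_zero[OF \<theta>] by (intro tendsto_intros E1 E2)
    then have lim: "(\<lambda>N. outer_measure_of (Q \<theta>) (E1 N) + outer_measure_of (Q \<theta>) (E2 N)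
        + outer_measure_of (Q \<theta>) E3) \<longlonglongrightarrow> 0" by simp
    show "(\<lambda>N. outer_measure_of (Q \<theta>) (E1 N \<union> E2 N \<union> E3)) \<longlonglongrightarrow> 0"
    proof (rule tendsto_sandwich[OF _ _ tendsto_const lim])
      have "outer_measure_of (Q \<theta>) (E1 N \<union> E2 N \<union> E3)
          \<le> outer_measure_of (Q \<theta>) (E1 N) + outer_measure_of (Q \<theta>) (E2 N) + outer_measure_of (Q \<theta>) E3" for N
        by (meson add_right_mono order_trans outer_measure_of_Un_le)
      then show "\<forall>\<^sub>F N in sequentially. outer_measure_of (Q \<theta>) (E1 N \<union> E2 N \<union> E3)
          \<le> outer_measure_of (Q \<theta>) (E1 N) + outer_measure_of (Q \<theta>) (E2 N) + outer_measure_of (Q \<theta>) E3"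
        by simp
    qed simp
  qed simp
qed

end
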